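(* Let $L>0$ and let $n\geq 1$ be an integer. Then $$\beta_{1,n}=\frac{2\pi n(n+1)}{L}\cot\frac{\pi n}{2(n+1)}.$$ Moreover $\beta_{1,n}$ is not attained, i.e. there is no $a\in\Lambda_n$ with $\|a-\lambda_n\|_{L^1(0,L)}=\beta_{1,n}$.
   Context: For $c,d\in L^1(0,L)$ write $c\prec d$ if $c(x)\le d(x)$ for a.e. $x\in[0,L]$ and $c(x)<d(x)$ on a set of positive measure. Let $\lambda_n=n^2\pi^2/L^2$ (an eigenvalue of $u''+\lambda u=0$ on $(0,L)$, $u'(0)=u'(L)=0$), also regarded as a constant function. For $a\in L^1(0,L)$ consider the Neumann problem $$u''(x)+a(x)u(x)=0,\ x\in(0,L),\qquad u'(0)=u'(L)=0,$$ with (real-valued) solutions $u$ in the Sobolev space $H^1(0,L)$, understood in the weak sense; a solution is nontrivial if it is not identically zero. Define $$\Lambda_n=\{a\in L^1(0,L):\ \lambda_n\prec a\ \text{and the Neumann problem above has nontrivial solutions}\},$$ $$\beta_{1,n}=\inf_{a\in\Lambda_n}\|a-\lambda_n\|_{L^1(0,L)}.$$ *)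

theory Defs
  imports "HOL-Analysis.Analysis"
begin

text \<open>Elements of Lebesgue and Sobolev spaces are represented by functions on the reals. Every notion
  below depends only on the almost-everywhere class of the restriction to \<open>(0, L)\<close>.\<close>

definition L1_space :: "real \<Rightarrow> (real \<Rightarrow> real) set" where
  "L1_space L = {f. integrable (lebesgue_on {0<..<L}) f}"

definition L1_norm :: "real \<Rightarrow> (real \<Rightarrow> real) \<Rightarrow> real" where
  "L1_norm L f = (LINT x|lebesgue_on {0<..<L}. \<bar>f x\<bar>)"

definition L2_space :: "real \<Rightarrow> (real \<Rightarrow> real) set" where
  "L2_space L = {f. f \<in> borel_measurable (lebesgue_on {0<..<L}) \<and>
                    integrable (lebesgue_on {0<..<L}) (\<lambda>x. (f x)\<^sup>2)}"

definition prec_ae :: "real \<Rightarrow> (real \<Rightarrow> real) \<Rightarrow> (real \<Rightarrow> real) \<Rightarrow> bool" where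
  "prec_ae L c d \<longleftrightarrow> (AE x in lebesgue_on {0..L}. c x \<le> d x) \<and>
                   emeasure lebesgue {x \<in> {0..L}. c x < d x} > 0"

text \<open>The space of infinitely differentiable functions with compact support in \<open>(0, L)\<close>,
  extended by zero to the whole line.\<close>

definition test_functions :: "real \<Rightarrow> (real \<Rightarrow> real) set" where
  "test_functions L = {\<phi>. (\<forall>k x. (deriv ^^ k) \<phi> differentiable (at x)) \<and>
                          compact (closure {x. \<phi> x \<noteq> 0}) \<and>
                          closure {x. \<phi> x \<noteq> 0} \<subseteq> {0<..<L}}"

definition has_weak_deriv :: "real \<Rightarrow> (real \<Rightarrow> real) \<Rightarrow> (real \<Rightarrow> real) \<Rightarrow> bool" where
  "has_weak_deriv L u v \<longleftrightarrow>
     (\<forall>\<phi>\<in>test_functions L. (LINT x|lebesgue_on {0<..<L}. u x * deriv \<phi> x) =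
                           - (LINT x|lebesgue_on {0<..<L}. v x * \<phi> x))"

definition H1_space :: "real \<Rightarrow> (real \<Rightarrow> real) set" where
  "H1_space L = {u \<in> L2_space L. \<exists>v\<in>L2_space L. has_weak_deriv L u v}"

text \<open>The weak derivative is unique only up to null sets, so the variational identity below is stated for
  all representatives. Testing against all of \<open>H\<^sup>1(0, L)\<close>, rather than only against functions vanishing at
  the end points, encodes the conditions \<open>u'(0) = u'(L) = 0\<close>. The integrand on the right is integrable since
  \<open>a\<close> is in \<open>L\<^sup>1\<close> and functions in \<open>H\<^sup>1(0, L)\<close> are essentially bounded.\<close>

definition weak_neumann_solution :: "real \<Rightarrow> (real \<Rightarrow> real) \<Rightarrow> (real \<Rightarrow> real) \<Rightarrow> bool" where
  "weak_neumann_solution L a u \<longleftrightarrow> u \<in> H1_space L \<and>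
     (\<forall>u'\<in>L2_space L. \<forall>\<psi>\<in>H1_space L. \<forall>\<psi>'\<in>L2_space L.
        has_weak_deriv L u u' \<longrightarrow> has_weak_deriv L \<psi> \<psi>' \<longrightarrow>
        (LINT x|lebesgue_on {0<..<L}. u' x * \<psi>' x) =
        (LINT x|lebesgue_on {0<..<L}. a x * u x * \<psi> x))"

definition nontrivial :: "real \<Rightarrow> (real \<Rightarrow> real) \<Rightarrow> bool" where
  "nontrivial L u \<longleftrightarrow> \<not> (AE x in lebesgue_on {0<..<L}. u x = 0)"

definition neumann_eigenvalue :: "real \<Rightarrow> nat \<Rightarrow> real" where
  "neumann_eigenvalue L n = (real n)\<^sup>2 * pi\<^sup>2 / L\<^sup>2"

definition Lambda_set :: "real \<Rightarrow> nat \<Rightarrow> (real \<Rightarrow> real) set" where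
  "Lambda_set L n = {a \<in> L1_space L. prec_ae L (\<lambda>x. neumann_eigenvalue L n) a \<and>
                       (\<exists>u. weak_neumann_solution L a u \<and> nontrivial L u)}"

text \<open>The infimum is taken in the extended reals, so that the infimum over an empty set would be \<open>\<infinity>\<close>.\<close>

definition beta1 :: "real \<Rightarrow> nat \<Rightarrow> ereal" where
  "beta1 L n = (INF a\<in>Lambda_set L n. ereal (L1_norm L (\<lambda>x. a x - neumann_eigenvalue L n)))"

end

theory Submission
  imports Defs
begin

text \<open>Put \<open>\<omega> = n \<pi> / L\<close> and \<open>q = a - \<omega>\<^sup>2 \<ge> 0\<close>. A weak solution is \<open>C\<^sup>1\<close> with absolutely continuous derivative, and
  \<open>[0, L]\<close> splits into quarter waves between consecutive zeros of \<open>u\<close> and \<open>u'\<close>. On a quarter wave of length \<open>\<lambda>\<close>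
  the Wronskian of \<open>u\<close> with a sine gives \<open>\<omega> \<lambda> \<le> \<pi> / 2\<close> and \<open>\<integral> q \<ge> \<omega> tan (\<pi> / 2 - \<omega> \<lambda>)\<close>, strictly if \<open>\<integral> q > 0\<close>. Adding
  these up for \<open>m\<close> half waves and bounding \<open>tan\<close> from below by its tangent at \<open>d = \<pi> / (2 (n + 1))\<close> yields a bound that
  increases with \<open>m\<close>; since \<open>m \<pi> > \<omega> L = n \<pi>\<close> forces \<open>m \<ge> n + 1\<close>, one gets \<open>\<integral> q > 2 (n + 1) \<omega> tan d\<close>. The bound is
  approached when \<open>q\<close> tends to a sum of point masses at the extrema of a function with \<open>n + 1\<close> equal half waves.\<close>

section \<open>Indefinite Lebesgue integrals\<close>

text \<open>The lengths of the quarter waves and their number are both unknown. Replacing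
  \<open>tan\<close> by a tangent line makes each bound affine in the length, so after summation the
  lengths enter only through their sum \<open>L\<close>, without Jensen's inequality. The point of
  tangency \<open>d\<close> is the value of \<open>\<pi> / 2 - \<omega> \<lambda>\<close> when
  \<open>n + 1\<close> half waves share \<open>[0, L]\<close> equally; the line is exact there, so
  nothing is lost in the constant. A quarter wave with positive \<open>\<integral> q\<close> is
  already strict, and strictness survives summation, so non-attainment comes together with the lower
  bound. The obstacle is regularity: \<open>q\<close> is merely integrable, so the equation holds
  only almost everywhere. For the lower bound all calculus is therefore done with pairs
  \<open>F\<close>, \<open>f\<close> such that increments of \<open>F\<close> are integrals of
  \<open>f\<close>. This form of absolute continuity is stable under products, reflection and
  changes of \<open>f\<close> on null sets, and solutions are never differentiated
  pointwise.\<close>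

definition primitive_on :: "real \<Rightarrow> real \<Rightarrow> (real \<Rightarrow> real) \<Rightarrow> (real \<Rightarrow> real) \<Rightarrow> bool" where
  "primitive_on a b F f \<longleftrightarrow> f absolutely_integrable_on {a..b} \<and>
     (\<forall>x y. a \<le> x \<longrightarrow> x \<le> y \<longrightarrow> y \<le> b \<longrightarrow> (f has_integral (F y - F x)) {x..y})"

lemma primitive_onD:
  assumes "primitive_on a b F f"
  shows "f absolutely_integrable_on {a..b}"
    and "\<lbrakk>a \<le> x; x \<le> y; y \<le> b\<rbrakk> \<Longrightarrow> (f has_integral (F y - F x)) {x..y}"
  using assms unfolding primitive_on_def by auto

lemma primitive_on_subinterval:
  assumes "primitive_on a b F f" "a \<le> c" "d \<le> b"
  shows "primitive_on c d F f"
  using assms absolutely_integrable_on_subinterval[where f = f and S = "{a..b}" and a = c and b = d]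
  unfolding primitive_on_def by auto

lemma primitive_on_integral:
  assumes "f absolutely_integrable_on {a..b}"
  shows "primitive_on a b (\<lambda>x. c + integral {a..x} f) f"
  unfolding primitive_on_def
proof (intro conjI allI impI assms)
  fix x y :: real assume xy: "a \<le> x" "x \<le> y" "y \<le> b"
  have i: "f integrable_on {a..b}" 
    using assms set_lebesgue_integral_eq_integral(1) by blast
  then have "integral {a..x} f + integral {x..y} f = integral {a..y} f"
    using xy by (intro Henstock_Kurzweil_Integration.integral_combine) (auto intro: integrable_on_subinterval)
  moreover have "(f has_integral integral {x..y} f) {x..y}"
    using xy i by (intro integrable_integral integrable_on_subinterval[OF i]) auto
  ultimately show "(f has_integral c + integral {a..y} f - (c + integral {a..x} f)) {x..y}"
    by (metis add_diff_cancel_left add_diff_cancel_left')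
qed

lemma primitive_on_continuous:
  assumes "primitive_on a b F f"
  shows "continuous_on {a..b} F"
proof -
  have i: "f integrable_on {a..b}" 
    using assms primitive_onD(1) set_lebesgue_integral_eq_integral(1) by blast
  have "continuous_on {a..b} (\<lambda>x. F a + integral {a..x} f)"
    by (intro continuous_intros indefinite_integral_continuous_1 i)
  moreover have "F x = F a + integral {a..x} f" if "x \<in> {a..b}" for x
    using primitive_onD(2)[OF assms, of a x] that by (auto dest: integral_unique)
  ultimately show ?thesis
    by (metis (no_types, lifting) continuous_on_cong)
qed

text \<open>At small scale, \<open>V\<close> dominates the increments of \<open>D\<close> with an
  arbitrarily small factor. Cutting \<open>{a..b}\<close> into \<open>N\<close> equal pieces shorter
  than \<open>d\<close> and telescoping carries the estimate over to the whole interval.\<close>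

lemma const_if_increment_small:
  fixes D V :: "real \<Rightarrow> real"
  assumes ab: "a \<le> b"
    and small: "\<And>e. e > 0 \<Longrightarrow> \<exists>d>0. \<forall>x y. a \<le> x \<longrightarrow> x \<le> y \<longrightarrow> y \<le> b \<longrightarrow> y - x < d \<longrightarrow>
                 \<bar>D y - D x\<bar> \<le> e * (V y - V x)"
  shows "D b = D a"
proof -
  have "\<bar>D b - D a\<bar> \<le> e * (V b - V a)" if e: "e > 0" for e
  proof -
    obtain d where d: "d > 0" "\<And>x y. a \<le> x \<Longrightarrow> x \<le> y \<Longrightarrow> y \<le> b \<Longrightarrow> y - x < d \<Longrightarrow>
       \<bar>D y - D x\<bar> \<le> e * (V y - V x)"
      using small[OF e] by blast
    obtain N :: nat where N: "(b - a) / d < real N" using reals_Archimedean2 by blast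
    have "N > 0" using N ab d by (intro gr0I) (auto simp: divide_simps split: if_splits)
    define p where "p k = a + real k * ((b - a) / real N)" for k
    have st: "p (Suc k) - p k = (b - a) / real N" for k by (simp add: p_def algebra_simps add_divide_distrib diff_divide_distrib)
    have lt: "(b - a) / real N < d" using N d \<open>N > 0\<close> by (simp add: field_simps)
    have nn: "(b - a) / real N \<ge> 0" using ab by simp
    have "p k \<le> p N" if "k \<le> N" for k
      unfolding p_def using that nn by (intro add_left_mono mult_right_mono) auto
    moreover have pN: "p N = b" using \<open>N > 0\<close> by (simp add: p_def)
    moreover have "p k \<ge> a" for k using nn mult_nonneg_nonneg[OF of_nat_0_le_iff[of k] nn] by (simp add: p_def)
    ultimately have *: "\<bar>D (p k) - D (p 0)\<bar> \<le> e * (V (p k) - V (p 0))" if "k \<le> N" for k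
      using that
    proof (induction k)
      case (Suc k)
      have "\<bar>D (p (Suc k)) - D (p k)\<bar> \<le> e * (V (p (Suc k)) - V (p k))"
        using Suc.prems st[of k] lt nn by (intro d) auto
      then show ?case using Suc by (simp add: algebra_simps)
    qed simp
    from *[of N] show ?thesis using pN by (simp add: p_def)
  qed
  then have 1: "\<bar>D b - D a\<bar> \<le> e * (V b - V a)" if "e > 0" for e using that by blast
  show ?thesis
  proof (rule ccontr)
    assume ne: "D b \<noteq> D a"
    then have pos: "V b - V a > 0" using 1[of 1] by simp
    \<comment> \<open>The factor \<open>e\<close> is chosen so that the right side is half of the
      left side.\<close>
    have "\<bar>D b - D a\<bar> \<le> \<bar>D b - D a\<bar> / (2 * (V b - V a)) * (V b - V a)"
      using ne pos by (intro 1) auto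
    then show False using ne pos by (simp add: field_simps)
  qed
qed

lemma absolutely_integrable_continuous_mult:
  fixes f g :: "real \<Rightarrow> real"
  assumes "continuous_on {a..b} f" "g absolutely_integrable_on {a..b}"
  shows "(\<lambda>x. f x * g x) absolutely_integrable_on {a..b}"
  using assms
  by (intro absolutely_integrable_bounded_measurable_product_real)
     (auto intro: continuous_imp_measurable_on_sets_lebesgue compact_imp_bounded compact_continuous_image)

lemma integral_abs_le_mult:
  fixes f h :: "real \<Rightarrow> real"
  assumes "(\<lambda>x. h x * f x) integrable_on {x..y}" "f absolutely_integrable_on {x..y}"
    "\<And>t. t \<in> {x..y} \<Longrightarrow> \<bar>h t\<bar> \<le> e"
  shows "\<bar>integral {x..y} (\<lambda>x. h x * f x)\<bar> \<le> e * integral {x..y} (\<lambda>t. \<bar>f t\<bar>)"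
proof -
  have "norm (integral {x..y} (\<lambda>x. h x * f x)) \<le> integral {x..y} (\<lambda>t. e * \<bar>f t\<bar>)"
    using assms absolutely_integrable_on_def
    by (intro integral_norm_bound_integral)
       (auto simp: abs_mult absolutely_integrable_on_def intro!: mult_right_mono integrable_on_mult_right)
  then show ?thesis by simp
qed

text \<open>The increment of \<open>F G\<close> minus the integral of \<open>f G + F g\<close> over a short interval is at most
  \<open>\<epsilon> (\<integral>|f| + \<integral>|g|)\<close> by uniform continuity, so no differentiability almost everywhere is needed.\<close>

lemma primitive_on_mult:
  assumes F: "primitive_on a b F f" and G: "primitive_on a b G g"
  shows "primitive_on a b (\<lambda>x. F x * G x) (\<lambda>x. f x * G x + F x * g x)"
proof -
  note cF = primitive_on_continuous[OF F] and cG = primitive_on_continuous[OF G]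
  note aF = primitive_onD(1)[OF F] and aG = primitive_onD(1)[OF G]
  have aFg: "(\<lambda>x. F x * g x) absolutely_integrable_on {a..b}"
    using absolutely_integrable_continuous_mult cF aG by blast
  have aGf: "(\<lambda>x. f x * G x) absolutely_integrable_on {a..b}"
    using absolutely_integrable_continuous_mult[OF cG aF] by (simp add: mult.commute)
  have ai: "(\<lambda>x. f x * G x + F x * g x) absolutely_integrable_on {a..b}"
    using aFg aGf set_integral_add(1) by blast
  define h where "h = (\<lambda>x. f x * G x + F x * g x)"
  note hi = set_lebesgue_integral_eq_integral(1)[OF ai, folded h_def]
  define D where "D x = F x * G x - integral {a..x} h" for x
  define V where "V x = integral {a..x} (\<lambda>t. \<bar>f t\<bar> + \<bar>g t\<bar>)" for x
  have aV: "(\<lambda>t. \<bar>f t\<bar> + \<bar>g t\<bar>) absolutely_integrable_on {a..b}"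
    using aF aG by (intro set_integral_add(1) set_integrable_abs)
  note Vi = set_lebesgue_integral_eq_integral(1)[OF aV]
  have key: "D y = D x" if xy: "a \<le> x" "x \<le> y" "y \<le> b" for x y
  proof (rule const_if_increment_small[where D = D and V = V and a = x and b = y])
    fix e :: real assume e: "e > 0"
    have "uniformly_continuous_on {a..b} F" "uniformly_continuous_on {a..b} G"
      using cF cG compact_uniformly_continuous by auto
    note u = this[unfolded uniformly_continuous_on_def dist_real_def]
    obtain d1 where d1: "d1 > 0"
      "\<And>s t. s \<in> {a..b} \<Longrightarrow> t \<in> {a..b} \<Longrightarrow> \<bar>s - t\<bar> < d1 \<Longrightarrow> \<bar>F s - F t\<bar> < e"
      using u(1)[rule_format, OF e] by auto
    obtain d2 where d2: "d2 > 0"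
      "\<And>s t. s \<in> {a..b} \<Longrightarrow> t \<in> {a..b} \<Longrightarrow> \<bar>s - t\<bar> < d2 \<Longrightarrow> \<bar>G s - G t\<bar> < e"
      using u(2)[rule_format, OF e] by auto
    show "\<exists>d>0. \<forall>u v. x \<le> u \<longrightarrow> u \<le> v \<longrightarrow> v \<le> y \<longrightarrow> v - u < d \<longrightarrow> \<bar>D v - D u\<bar> \<le> e * (V v - V u)"
    proof (intro exI[of _ "min d1 d2"] conjI allI impI)
      fix u v assume uv: "x \<le> u" "u \<le> v" "v \<le> y" "v - u < min d1 d2"
      have sub: "{u..v} \<subseteq> {a..b}" "a \<le> u" "u \<le> v" "v \<le> b" using uv xy by auto
      have fi: "f absolutely_integrable_on {u..v}" "g absolutely_integrable_on {u..v}"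
        using aF aG sub by (auto intro: absolutely_integrable_on_subinterval)
      have Fv: "F v - F u = integral {u..v} f" and Gv: "G v - G u = integral {u..v} g"
        using primitive_onD(2)[OF F sub(2-4)] primitive_onD(2)[OF G sub(2-4)] by (auto dest: integral_unique)
      have i1: "(\<lambda>t. (G v - G t) * f t) absolutely_integrable_on {u..v}"
        using fi sub continuous_on_subset[OF cG] 
        by (intro absolutely_integrable_continuous_mult continuous_intros) auto
      have i2: "(\<lambda>t. (F u - F t) * g t) absolutely_integrable_on {u..v}"
        using fi sub continuous_on_subset[OF cF] 
        by (intro absolutely_integrable_continuous_mult continuous_intros) auto
      note i3 = set_lebesgue_integral_eq_integral(1)[OF i1] set_lebesgue_integral_eq_integral(1)[OF i2]
        set_lebesgue_integral_eq_integral(1)[OF fi(1)] set_lebesgue_integral_eq_integral(1)[OF fi(2)]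
      have hv: "h integrable_on {u..v}" using hi sub integrable_on_subinterval by blast
      have Dv: "D v - D u = F v * G v - F u * G u - integral {u..v} h"
        unfolding D_def 
        using Henstock_Kurzweil_Integration.integral_combine[OF sub(2,3) integrable_on_subinterval[OF hi]] sub by auto
      \<comment> \<open>The product increment is \<open>G v\<close> times the increment of
        \<open>F\<close> plus \<open>F u\<close> times the increment of \<open>G\<close>. With these
        frozen coefficients, subtracting \<open>h\<close> leaves the small factors
        \<open>G v - G t\<close> and \<open>F u - F t\<close>.\<close>
      also have "F v * G v - F u * G u = integral {u..v} (\<lambda>t. G v * f t + F u * g t)"
        using i3 by (subst Henstock_Kurzweil_Integration.integral_add) 
           (auto simp: Fv[symmetric] Gv[symmetric] algebra_simps intro!: integrable_on_mult_right)
      also have "\<dots> - integral {u..v} h = integral {u..v} (\<lambda>t. (G v * f t + F u * g t) - h t)"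
        using i3 hv by (intro Henstock_Kurzweil_Integration.integral_diff[symmetric] integrable_add integrable_on_mult_right) auto
      also have "\<dots> = integral {u..v} (\<lambda>t. (G v - G t) * f t + (F u - F t) * g t)"
        by (simp add: h_def algebra_simps)
      also have "\<dots> = integral {u..v} (\<lambda>t. (G v - G t) * f t) + integral {u..v} (\<lambda>t. (F u - F t) * g t)"
        using i3 by (intro Henstock_Kurzweil_Integration.integral_add) auto
      finally have Dvu: "D v - D u = integral {u..v} (\<lambda>t. (G v - G t) * f t) + integral {u..v} (\<lambda>t. (F u - F t) * g t)" .
      have b1: "\<bar>integral {u..v} (\<lambda>t. (G v - G t) * f t)\<bar> \<le> e * integral {u..v} (\<lambda>t. \<bar>f t\<bar>)"
        using sub uv by (intro integral_abs_le_mult i3 fi less_imp_le[OF d2(2)]) auto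
      have b2: "\<bar>integral {u..v} (\<lambda>t. (F u - F t) * g t)\<bar> \<le> e * integral {u..v} (\<lambda>t. \<bar>g t\<bar>)"
        using sub uv by (intro integral_abs_le_mult i3 fi less_imp_le[OF d1(2)]) auto
      have "V v - V u = integral {u..v} (\<lambda>t. \<bar>f t\<bar> + \<bar>g t\<bar>)"
        unfolding V_def 
        using Henstock_Kurzweil_Integration.integral_combine[OF sub(2,3) integrable_on_subinterval[OF Vi]] sub by auto
      also have "\<dots> = integral {u..v} (\<lambda>t. \<bar>f t\<bar>) + integral {u..v} (\<lambda>t. \<bar>g t\<bar>)"
        using fi by (intro Henstock_Kurzweil_Integration.integral_add) (auto simp: absolutely_integrable_on_def)
      finally show "\<bar>D v - D u\<bar> \<le> e * (V v - V u)" using b1 b2 Dvu by (simp add: algebra_simps)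
    qed (use d1 d2 in auto)
  qed (use xy in auto)
  show ?thesis
    unfolding primitive_on_def
  proof (intro conjI allI impI ai)
    fix x y :: real assume xy: "a \<le> x" "x \<le> y" "y \<le> b"
    have "integral {x..y} h = F y * G y - F x * G x"
      using key[OF xy] Henstock_Kurzweil_Integration.integral_combine[OF xy(1,2) integrable_on_subinterval[OF hi]] xy
      by (auto simp: D_def)
    moreover have "h integrable_on {x..y}" using hi xy integrable_on_subinterval[of h "{a..b}" x y] by auto
    ultimately show "((\<lambda>x. f x * G x + F x * g x) has_integral F y * G y - F x * G x) {x..y}"
      unfolding h_def by (metis integrable_integral)
  qed
qed

lemma primitive_on_diff:
  assumes "primitive_on a b F f" "primitive_on a b G g"
  shows "primitive_on a b (\<lambda>x. F x - G x) (\<lambda>x. f x - g x)"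
  unfolding primitive_on_def
proof (intro conjI allI impI)
  show "(\<lambda>x. f x - g x) absolutely_integrable_on {a..b}"
    using assms primitive_onD(1) set_integral_diff(1) by blast
  fix x y assume xy: "a \<le> x" "x \<le> y" "y \<le> b"
  show "((\<lambda>x. f x - g x) has_integral F y - G y - (F x - G x)) {x..y}"
    using has_integral_diff[OF primitive_onD(2)[OF assms(1) xy] primitive_onD(2)[OF assms(2) xy]]
    by (simp add: algebra_simps)
qed

lemma primitive_on_uminus:
  assumes "primitive_on a b F f"
  shows "primitive_on a b (\<lambda>x. - F x) (\<lambda>x. - f x)"
proof -
  have "primitive_on a b (\<lambda>x. 0) (\<lambda>x. 0)" by (auto simp: primitive_on_def)
  from primitive_on_diff[OF this assms] show ?thesis by simp
qed

lemma primitive_on_cong: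
  assumes "primitive_on a b F f" "\<And>x. x \<in> {a..b} \<Longrightarrow> F x = G x" "\<And>x. x \<in> {a..b} \<Longrightarrow> f x = g x"
  shows "primitive_on a b G g"
  unfolding primitive_on_def
proof (intro conjI allI impI)
  show "g absolutely_integrable_on {a..b}"
    by (rule absolutely_integrable_spike[OF primitive_onD(1)[OF assms(1)], of "{}"]) (use assms(3) in auto)
  fix x y assume xy: "a \<le> x" "x \<le> y" "y \<le> b"
  have "(f has_integral G y - G x) {x..y}" using primitive_onD(2)[OF assms(1) xy] assms(2) xy by auto
  then show "(g has_integral G y - G x) {x..y}" 
    by (rule has_integral_eq[rotated]) (use assms(3) xy in auto)
qed

lemma primitive_on_AE:
  assumes "primitive_on a b F f" "AE x in lebesgue_on {a<..<b}. f x = g x"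
  shows "primitive_on a b F g"
proof -
  have "AE x in lebesgue. x \<in> {a<..<b} \<longrightarrow> f x = g x"
    using assms(2) by (subst (asm) AE_restrict_space_iff) auto
  then obtain N where N: "negligible N" "\<And>x. x \<notin> N \<Longrightarrow> x \<in> {a<..<b} \<Longrightarrow> f x = g x"
    by (auto simp: eventually_ae_filter negligible_iff_null_sets subset_eq)
  \<comment> \<open>The hypothesis says nothing about the end points, so these join the null
    set.\<close>
  define S where "S = N \<union> {a,b}"
  have S: "negligible S" "\<And>x. x \<in> {a..b} - S \<Longrightarrow> g x = f x" 
    using N unfolding S_def by (auto intro!: negligible_Un N)
  show ?thesis
    unfolding primitive_on_def
  proof (intro conjI allI impI)
    show "g absolutely_integrable_on {a..b}"
      using absolutely_integrable_spike[OF primitive_onD(1)[OF assms(1)] S] by blast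
    fix x y assume xy: "a \<le> x" "x \<le> y" "y \<le> b"
    show "(g has_integral F y - F x) {x..y}"
      using has_integral_spike[OF S(1) _ primitive_onD(2)[OF assms(1) xy], of g] S(2) xy by auto
  qed
qed

text \<open>Turns a quarter wave running from a zero to an extremum into one running from an
  extremum to a zero, so that a single estimate serves both.\<close>

lemma primitive_on_reflect:
  assumes "primitive_on a b F f"
  shows "primitive_on (- b) (- a) (\<lambda>x. - F (- x)) (\<lambda>x. f (- x))"
  unfolding primitive_on_def
proof (intro conjI allI impI)
  show "(\<lambda>x. f (- x)) absolutely_integrable_on {- b..- a}"
    using primitive_onD(1)[OF assms] by simp
  fix x y assume "- b \<le> x" "x \<le> y" "y \<le> - a"
  then have "(f has_integral (F (- x) - F (- y))) {- y..- x}"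
    by (intro primitive_onD(2)[OF assms]) auto
  from has_integral_reflect_real[THEN iffD2, OF this]
  show "((\<lambda>x. f (- x)) has_integral - F (- y) - - F (- x)) {x..y}" by simp
qed

section \<open>The equation on a quarter wave\<close>

lemma primitive_on_derivative:
  assumes "\<And>x. x \<in> {a..b} \<Longrightarrow> (F has_real_derivative f x) (at x)" "continuous_on {a..b} f"
  shows "primitive_on a b F f"
  unfolding primitive_on_def
proof (intro conjI allI impI)
  show "f absolutely_integrable_on {a..b}"
    using assms(2) absolutely_integrable_continuous_real by blast
  fix x y assume "a \<le> x" "x \<le> y" "y \<le> b"
  then show "(f has_integral F y - F x) {x..y}"
    using assms(1)
    by (intro fundamental_theorem_of_calculus)
       (auto simp: has_real_derivative_iff_has_vector_derivative[symmetric] intro: has_field_derivative_at_within)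
qed

text \<open>The sine solves the equation with \<open>q = 0\<close>, so the
  \<open>\<omega>\<^sup>2\<close> terms cancel and only \<open>q\<close> survives. The free phase
  \<open>\<theta>\<close> lets the sine vanish, or have zero slope, at a prescribed point.\<close>

lemma primitive_on_wronskian:
  fixes \<omega> \<theta> :: real
  assumes u: "primitive_on a b u v" and v: "primitive_on a b v (\<lambda>x. - ((\<omega>\<^sup>2 + q x) * u x))"
  shows "primitive_on a b (\<lambda>t. v t * sin (\<omega> * t + \<theta>) - u t * (\<omega> * cos (\<omega> * t + \<theta>)))
           (\<lambda>t. - (q t * u t * sin (\<omega> * t + \<theta>)))"
proof -
  have s: "primitive_on a b (\<lambda>t. sin (\<omega> * t + \<theta>)) (\<lambda>t. \<omega> * cos (\<omega> * t + \<theta>))"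
    by (rule primitive_on_derivative) (auto intro!: derivative_eq_intros continuous_intros)
  have c: "primitive_on a b (\<lambda>t. \<omega> * cos (\<omega> * t + \<theta>)) (\<lambda>t. - (\<omega>\<^sup>2 * sin (\<omega> * t + \<theta>)))"
    by (rule primitive_on_derivative) (auto intro!: derivative_eq_intros continuous_intros simp: power2_eq_square)
  show ?thesis
    by (rule primitive_on_cong[OF primitive_on_diff[OF primitive_on_mult[OF v s] primitive_on_mult[OF u c]]])
       (auto simp: algebra_simps)
qed

text \<open>A vanishing integral would force \<open>g q = 0\<close> almost everywhere, hence
  \<open>q = 0\<close> off a null set containing the end points, against the positive integral of
  \<open>q\<close>. The strict bounds on \<open>\<integral> q\<close> originate here.\<close>

lemma integral_continuous_mult_pos:
  fixes q g :: "real \<Rightarrow> real"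
  assumes q: "q absolutely_integrable_on {a..b}" "\<And>x. x \<in> {a..b} \<Longrightarrow> 0 \<le> q x" "0 < integral {a..b} q"
    and g: "continuous_on {a..b} g" "\<And>x. x \<in> {a..b} \<Longrightarrow> 0 \<le> g x" "\<And>x. x \<in> {a<..<b} \<Longrightarrow> 0 < g x"
  shows "0 < integral {a..b} (\<lambda>x. g x * q x)"
proof -
  have gq: "(\<lambda>x. g x * q x) absolutely_integrable_on {a..b}"
    using absolutely_integrable_continuous_mult g(1) q(1) by blast
  have i: "integrable (lebesgue_on {a..b}) (\<lambda>x. g x * q x)"
    using absolutely_integrable_imp_integrable[OF gq] by simp
  have nn: "integral {a..b} (\<lambda>x. g x * q x) \<ge> 0"
    using gq q g by (intro Henstock_Kurzweil_Integration.integral_nonneg set_lebesgue_integral_eq_integral) auto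
  have "integral {a..b} (\<lambda>x. g x * q x) \<noteq> 0"
  proof
    assume "integral {a..b} (\<lambda>x. g x * q x) = 0"
    then have "(LINT x|lebesgue_on {a..b}. g x * q x) = 0"
      using lebesgue_integral_eq_integral[OF i] by simp
    then have "AE x in lebesgue_on {a..b}. g x * q x = 0"
      using i q g by (subst (asm) integral_nonneg_eq_0_iff_AE) (auto intro!: AE_I2)
    then have "AE x in lebesgue. x \<in> {a..b} \<longrightarrow> g x * q x = 0"
      by (subst (asm) AE_restrict_space_iff) auto
    then obtain N where N: "negligible N" "\<And>x. x \<notin> N \<Longrightarrow> x \<in> {a..b} \<Longrightarrow> g x * q x = 0"
      by (auto simp: eventually_ae_filter negligible_iff_null_sets subset_eq)
    have "integral {a..b} q = integral {a..b} (\<lambda>x. 0)"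
    proof (rule integral_spike)
      show "negligible (N \<union> {a, b})" using N by auto
      fix x assume "x \<in> {a..b} - (N \<union> {a, b})"
      then show "0 = q x" using N(2)[of x] g(3)[of x] by auto
    qed
    then show False using q(3) by simp
  qed
  then show ?thesis using nn by simp
qed

text \<open>Convexity of \<open>tan\<close> on \<open>[0, \<pi>/2)\<close>: its derivative
  \<open>1 / (cos z)\<^sup>2\<close> increases, and the mean value theorem compares it with its
  value at \<open>d\<close> on either side.\<close>

lemma tan_above_tangent:
  fixes x d :: real
  assumes "0 \<le> x" "x < pi / 2" "0 \<le> d" "d < pi / 2"
  shows "tan d + (x - d) / (cos d)\<^sup>2 \<le> tan x"
proof -
  have pos: "cos x > 0" "cos d > 0" using assms by (auto intro!: cos_gt_zero_pi)
  have c: "inverse ((cos a)\<^sup>2) \<le> inverse ((cos b)\<^sup>2)" if "0 \<le> a" "a \<le> b" "b < pi / 2" for a b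
    using that cos_monotone_0_pi_le[of a b] cos_gt_zero[of b] cos_gt_zero_pi[of b]
    by (intro le_imp_inverse_le power_mono zero_less_power) auto
  have D: "(tan has_real_derivative inverse ((cos z)\<^sup>2)) (at z)" if "0 \<le> z" "z < pi / 2" for z :: real
    using that cos_gt_zero_pi[of z] by (intro DERIV_tan) auto
  consider "x = d" | "x < d" | "d < x" by linarith
  then show ?thesis
  proof cases
    case 2
    obtain z where z: "x < z" "z < d" "tan d - tan x = (d - x) * inverse ((cos z)\<^sup>2)"
      using MVT2[OF 2, of tan "\<lambda>z. inverse ((cos z)\<^sup>2)"] D assms by auto
    have "tan d - tan x \<le> (d - x) * inverse ((cos d)\<^sup>2)"
      unfolding z(3) using z assms 2 by (intro mult_left_mono c) auto
    then show ?thesis by (simp add: divide_inverse algebra_simps)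
  next
    case 3
    obtain z where z: "d < z" "z < x" "tan x - tan d = (x - d) * inverse ((cos z)\<^sup>2)"
      using MVT2[OF 3, of tan "\<lambda>z. inverse ((cos z)\<^sup>2)"] D assms by auto
    have "tan x - tan d \<ge> (x - d) * inverse ((cos d)\<^sup>2)"
      unfolding z(3) using z assms 3 by (intro mult_left_mono c) auto
    then show ?thesis by (simp add: divide_inverse algebra_simps)
  qed simp
qed

text \<open>The Wronskian of \<open>u\<close> with \<open>sin (\<omega> (r - t))\<close> gives
  \<open>\<omega> u(p) cos (\<omega> (r - p)) = \<integral> q u sin (\<omega> (r - t))\<close>, and \<open>u \<le> u(p)\<close> since \<open>u\<close> decreases.\<close>

lemma quarter_wave:
  fixes \<omega> p r d :: real
  assumes "\<omega> > 0" "p < r" and d: "0 \<le> d" "d < pi / 2"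
    and u: "primitive_on p r u v" and v: "primitive_on p r v (\<lambda>x. - ((\<omega>\<^sup>2 + q x) * u x))"
    and q: "q absolutely_integrable_on {p..r}" "\<And>x. x \<in> {p..r} \<Longrightarrow> 0 \<le> q x"
    and bd: "v p = 0" "u r = 0" and pos: "\<And>x. x \<in> {p..<r} \<Longrightarrow> u x > 0"
  defines "K \<equiv> integral {p..r} q" and "l \<equiv> r - p"
  shows "\<omega> * l \<le> pi / 2"
    and "\<omega> * cos (\<omega> * l) \<le> K * sin (\<omega> * l)"
    and "\<omega> * (tan d + (pi / 2 - \<omega> * l - d) / (cos d)\<^sup>2) \<le> K"
    and "K > 0 \<Longrightarrow> \<omega> * l < pi / 2"
    and "K > 0 \<Longrightarrow> \<omega> * (tan d + (pi / 2 - \<omega> * l - d) / (cos d)\<^sup>2) < K"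
proof -
  note cu = primitive_on_continuous[OF u] and cv = primitive_on_continuous[OF v]
  have nn: "u x \<ge> 0" if "x \<in> {p..r}" for x using pos[of x] bd that by (cases "x = r") (auto simp: less_imp_le)
  \<comment> \<open>Since \<open>u\<close> is nonnegative, \<open>v\<close> decreases from
    \<open>v p = 0\<close>; hence \<open>u\<close> decreases from its maximum at
    \<open>p\<close>.\<close>
  have vneg: "v x \<le> 0" if "x \<in> {p..r}" for x
  proof -
    have "((\<lambda>x. - ((\<omega>\<^sup>2 + q x) * u x)) has_integral v x - v p) {p..x}"
      using that by (intro primitive_onD(2)[OF v]) auto
    then have "v x - v p \<le> 0"
      by (rule has_integral_le[OF _ has_integral_0]) (use that nn q in auto)
    then show ?thesis using bd by simp
  qed
  have ule: "u x \<le> u p" if "x \<in> {p..r}" for x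
  proof -
    have "(v has_integral u x - u p) {p..x}"
      using that by (intro primitive_onD(2)[OF u]) auto
    then have "u x - u p \<le> 0"
      by (rule has_integral_le[OF _ has_integral_0]) (use that vneg in auto)
    then show ?thesis by simp
  qed
  have up: "u p > 0" using pos \<open>p < r\<close> by auto
  show l: "\<omega> * l \<le> pi / 2"
  proof (rule ccontr)
    assume "\<not> \<omega> * l \<le> pi / 2"
    \<comment> \<open>A quarter period after \<open>p\<close>. The comparison function below is
      \<open>cos (\<omega> (t - p))\<close>: it has zero slope at \<open>p\<close>, like
      \<open>u\<close>, and its first zero at \<open>e\<close>. The Wronskian would grow by
      \<open>\<omega> u(e) > 0\<close> although its density is nonpositive.\<close>
    define e where "e = p + pi / (2 * \<omega>)"
    have e: "p < e" "e < r" using \<open>\<not> _\<close> \<open>\<omega> > 0\<close> by (auto simp: e_def l_def field_simps)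
    have we: "\<omega> * e + (pi / 2 - \<omega> * p) = pi" "\<omega> * p + (pi / 2 - \<omega> * p) = pi / 2"
      using \<open>\<omega> > 0\<close> by (auto simp: e_def field_simps)
    let ?s = "\<lambda>t. \<omega> * t + (pi / 2 - \<omega> * p)"
    have "((\<lambda>t. - (q t * u t * sin (?s t))) has_integral
        v e * sin (?s e) - u e * (\<omega> * cos (?s e)) - (v p * sin (?s p) - u p * (\<omega> * cos (?s p)))) {p..e}"
      using e by (intro primitive_onD(2)[OF primitive_on_wronskian[OF u v]]) auto
    then have "((\<lambda>t. - (q t * u t * sin (?s t))) has_integral u e * \<omega>) {p..e}"
      using bd unfolding we by simp
    then have "u e * \<omega> \<le> 0"
    proof (rule has_integral_le[OF _ has_integral_0])
      fix t assume t: "t \<in> {p..e}"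
      have "\<omega> * t \<le> \<omega> * e" "\<omega> * p \<le> \<omega> * t" using t \<open>\<omega> > 0\<close> by auto
      then have "sin (?s t) \<ge> 0" using we by (intro sin_ge_zero) auto
      then show "- (q t * u t * sin (?s t)) \<le> 0" using q(2)[of t] nn[of t] t e by auto
    qed
    moreover have "u e > 0" using pos e by simp
    ultimately show False using \<open>\<omega> > 0\<close> by (simp add: mult_le_0_iff)
  qed
  have l0: "0 < \<omega> * l" using assms by (simp add: l_def)
  have sl: "sin (\<omega> * l) > 0" using l l0 by (intro sin_gt_zero) auto
  define g where "g t = u t * sin (\<omega> * (r - t))" for t
  have cg: "continuous_on {p..r} g" unfolding g_def by (intro continuous_intros cu)
  have ang: "0 \<le> \<omega> * (r - t)" "\<omega> * (r - t) \<le> \<omega> * l" if "t \<in> {p..r}" for t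
    using that \<open>\<omega> > 0\<close> by (auto simp: l_def)
  have ang': "0 < \<omega> * (r - t)" "\<omega> * (r - t) < \<omega> * l" if "t \<in> {p<..<r}" for t
    using that \<open>\<omega> > 0\<close> by (auto simp: l_def)
  have g0: "0 \<le> g t" if "t \<in> {p..r}" for t
    unfolding g_def using nn[OF that] ang[OF that] l by (intro mult_nonneg_nonneg[OF nn[OF that]] sin_ge_zero) linarith+
  have g0': "0 < g t" if t: "t \<in> {p<..<r}" for t
  proof -
    have "sin (\<omega> * (r - t)) > 0" using ang'[OF t] l by (intro sin_gt_zero) linarith+
    then show ?thesis unfolding g_def using pos[of t] t by simp
  qed
  \<comment> \<open>This is \<open>g p\<close>. Both factors of \<open>g\<close> are largest at
    \<open>p\<close>: \<open>u\<close> decreases, and the angle \<open>\<omega> (r - t)\<close>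
    stays in \<open>[0, \<pi>/2]\<close>, where the sine increases.\<close>
  define M where "M = u p * sin (\<omega> * l)"
  have gM: "g t \<le> M" if t: "t \<in> {p..r}" for t
  proof -
    have "sin (\<omega> * (r - t)) \<le> sin (\<omega> * l)" using ang[OF t] l by (intro sin_monotone_2pi_le) linarith+
    then have "u t * sin (\<omega> * (r - t)) \<le> u t * sin (\<omega> * l)" using nn[OF t] by (rule mult_left_mono)
    also have "\<dots> \<le> M" using ule[OF t] sl by (simp add: M_def)
    finally show ?thesis by (simp add: g_def)
  qed
  have gM': "g t < M" if t: "t \<in> {p<..<r}" for t
  proof -
    have "sin (\<omega> * (r - t)) < sin (\<omega> * l)" using ang'[OF t] l by (intro sin_monotone_2pi) linarith+
    then have "u t * sin (\<omega> * (r - t)) < u t * sin (\<omega> * l)" using pos[of t] t by simp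
    also have "\<dots> \<le> M" using ule[of t] t sl by (simp add: M_def)
    finally show ?thesis by (simp add: g_def)
  qed
  have aq: "(\<lambda>t. g t * q t) absolutely_integrable_on {p..r}"
    using absolutely_integrable_continuous_mult[OF cg q(1)] .
  note qi = set_lebesgue_integral_eq_integral(1)[OF q(1)] and gqi = set_lebesgue_integral_eq_integral(1)[OF aq]
  have eq: "integral {p..r} (\<lambda>t. g t * q t) = \<omega> * u p * cos (\<omega> * l)"
  proof -
    let ?s = "\<lambda>t. \<omega> * t + (- (\<omega> * r))"
    have "((\<lambda>t. - (q t * u t * sin (?s t))) has_integral
        v r * sin (?s r) - u r * (\<omega> * cos (?s r)) - (v p * sin (?s p) - u p * (\<omega> * cos (?s p)))) {p..r}"
      using \<open>p < r\<close> by (intro primitive_onD(2)[OF primitive_on_wronskian[OF u v]]) auto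
    note I = this
    have sc: "sin (?s t) = - sin (\<omega> * (r - t))" "cos (?s t) = cos (\<omega> * (r - t))" for t
      using sin_minus[of "\<omega> * (r - t)"] cos_minus[of "\<omega> * (r - t)"] by (simp_all add: algebra_simps)
    have "((\<lambda>t. g t * q t) has_integral \<omega> * u p * cos (\<omega> * l)) {p..r}"
      using I[unfolded sc] bd by (simp add: g_def l_def mult_ac)
    then show ?thesis by (rule integral_unique)
  qed
  have "integral {p..r} (\<lambda>t. g t * q t) \<le> integral {p..r} (\<lambda>t. M * q t)"
    using gM q(2) qi gqi by (intro integral_le mult_right_mono integrable_on_mult_right) auto
  then have "u p * (\<omega> * cos (\<omega> * l)) \<le> u p * (K * sin (\<omega> * l))"
    unfolding eq by (simp add: K_def M_def mult_ac)
  then show le: "\<omega> * cos (\<omega> * l) \<le> K * sin (\<omega> * l)" using up by simp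
  have tl: "tan (pi / 2 - \<omega> * l) = cos (\<omega> * l) / sin (\<omega> * l)"
    by (simp add: tan_def sin_diff cos_diff)
  have tang: "tan d + (pi / 2 - \<omega> * l - d) / (cos d)\<^sup>2 \<le> cos (\<omega> * l) / sin (\<omega> * l)"
    using tan_above_tangent[of "pi / 2 - \<omega> * l" d] l l0 d unfolding tl by auto
  then have T: "\<omega> * (tan d + (pi / 2 - \<omega> * l - d) / (cos d)\<^sup>2) \<le> \<omega> * (cos (\<omega> * l) / sin (\<omega> * l))"
    using \<open>\<omega> > 0\<close> by (intro mult_left_mono) auto
  also have "\<dots> \<le> K" using le sl by (simp add: field_simps)
  finally show "\<omega> * (tan d + (pi / 2 - \<omega> * l - d) / (cos d)\<^sup>2) \<le> K" .
  {
    assume K: "K > 0"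
    have "0 < integral {p..r} (\<lambda>t. g t * q t)"
      using q K g0 g0' cg unfolding K_def by (intro integral_continuous_mult_pos) auto
    then have "0 < (\<omega> * u p) * cos (\<omega> * l)" unfolding eq .
    then have "cos (\<omega> * l) > 0" using zero_less_mult_pos mult_pos_pos[OF \<open>\<omega> > 0\<close> up] by blast
    then show "\<omega> * l < pi / 2" using l cos_pi_half by (metis less_irrefl order_le_less)
    \<comment> \<open>Inside the interval \<open>g < M\<close>, so as soon as \<open>q\<close> has
      positive mass, replacing \<open>g\<close> by \<open>M\<close> loses a positive amount.\<close>
    have "0 < integral {p..r} (\<lambda>t. (M - g t) * q t)"
      using q K gM gM' cg unfolding K_def by (intro integral_continuous_mult_pos continuous_intros) auto
    also have "\<dots> = integral {p..r} (\<lambda>t. M * q t - g t * q t)" by (simp add: algebra_simps)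
    also have "\<dots> = M * K - \<omega> * u p * cos (\<omega> * l)"
      using qi gqi by (subst Henstock_Kurzweil_Integration.integral_diff) (auto simp: K_def eq intro!: integrable_on_mult_right)
    finally have "u p * (\<omega> * cos (\<omega> * l)) < u p * (K * sin (\<omega> * l))" by (simp add: M_def mult_ac)
    then have "\<omega> * cos (\<omega> * l) < K * sin (\<omega> * l)" using up by simp
    then have "\<omega> * (cos (\<omega> * l) / sin (\<omega> * l)) < K" using sl by (simp add: field_simps)
    then show "\<omega> * (tan d + (pi / 2 - \<omega> * l - d) / (cos d)\<^sup>2) < K" using T by simp
  }
qed

section \<open>Counting half waves\<close>

lemma first_zero:
  fixes f :: "real \<Rightarrow> real"
  assumes f: "continuous_on {a..b} f" "f a > 0" and z: "z \<in> {a..b}" "f z = 0"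
  obtains r where "a < r" "r \<le> b" "f r = 0" "\<And>x. x \<in> {a..<r} \<Longrightarrow> f x > 0"
proof -
  define Z where "Z = {x \<in> {a..b}. f x = 0}"
  have "closed Z" unfolding Z_def using continuous_closed_preimage_constant[OF f(1)] by auto
  then have "compact Z"
    unfolding Z_def by (metis (no_types, lifting) bounded_closed_interval bounded_subset compact_eq_bounded_closed mem_Collect_eq subsetI)
  moreover have "Z \<noteq> {}" using z by (auto simp: Z_def)
  ultimately obtain r where r: "r \<in> Z" "\<And>x. x \<in> Z \<Longrightarrow> r \<le> x"
    using compact_attains_inf[of Z] by auto
  have "f x > 0" if x: "x \<in> {a..<r}" for x
  proof (rule ccontr)
    assume "\<not> f x > 0"
    then obtain y where "a \<le> y" "y \<le> x" "f y = 0"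
      using IVT2'[of f x 0 a] x r f continuous_on_subset[OF f(1), of "{a..x}"] by (auto simp: Z_def)
    then show False using r(2)[of y] x r(1) by (auto simp: Z_def)
  qed
  then show ?thesis
    using r(1) f(2) by (intro that[of r]) (auto simp: Z_def order_less_le)
qed

text \<open>The slope \<open>v r\<close> is minus the integral of \<open>(c + q) u\<close>, and the
  constant \<open>c > 0\<close> keeps that integral positive even where \<open>q\<close> vanishes.
  This excludes a positive \<open>u\<close> on all of an interval with zero slope at both ends, and
  it makes \<open>u\<close> cross its first zero transversally.\<close>

lemma slope_neg:
  fixes c :: real
  assumes "c > 0" "p < r" "primitive_on p r u v" "primitive_on p r v (\<lambda>x. - ((c + q x) * u x))"
    and q: "q absolutely_integrable_on {p..r}" "\<And>x. x \<in> {p..r} \<Longrightarrow> 0 \<le> q x"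
    and "v p = 0" "\<And>x. x \<in> {p..r} \<Longrightarrow> u x \<ge> 0" "\<And>x. x \<in> {p..<r} \<Longrightarrow> u x > 0"
  shows "v r < 0"
proof -
  have ci: "(\<lambda>x. c + q x) absolutely_integrable_on {p..r}"
    by (intro set_integral_add(1) q(1) absolutely_integrable_continuous_real[OF continuous_on_const])
  have "integral {p..r} (\<lambda>x. c) \<le> integral {p..r} (\<lambda>x. c + q x)"
    using set_lebesgue_integral_eq_integral(1)[OF ci] q(2) by (intro integral_le) auto
  moreover have "integral {p..r} (\<lambda>x. c) = c * (r - p)" using \<open>p < r\<close> by simp
  moreover have "0 < c * (r - p)" using assms by simp
  ultimately have pos: "0 < integral {p..r} (\<lambda>x. c + q x)" by linarith
  have "0 < integral {p..r} (\<lambda>x. u x * (c + q x))"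
  proof (rule integral_continuous_mult_pos[OF ci _ pos primitive_on_continuous[OF assms(3)]])
    show "0 \<le> c + q x" if "x \<in> {p..r}" for x using q(2)[OF that] \<open>c > 0\<close> by simp
  qed (use assms(8,9) in auto)
  moreover have "((\<lambda>x. - ((c + q x) * u x)) has_integral v r - v p) {p..r}"
    using primitive_onD(2)[OF assms(4)] \<open>p < r\<close> by auto
  from integral_unique[OF has_integral_neg[OF this]] have "integral {p..r} (\<lambda>x. u x * (c + q x)) = - v r"
    using assms(7) by (simp add: mult.commute)
  ultimately show ?thesis by simp
qed

text \<open>The part of the tangent-line bound for one half wave that is independent of length:
  summed over its two quarter waves, the bound is \<open>\<omega>\<close> times
  \<open>wave_gain d\<close> minus the total phase divided by
  \<open>(cos d)\<^sup>2\<close>.\<close>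

definition wave_gain :: "real \<Rightarrow> real" where
  "wave_gain d = 2 * tan d + (pi - 2 * d) / (cos d)\<^sup>2"

text \<open>From an extremum \<open>p\<close>, the function must reach a zero \<open>r\<close>,
  since otherwise \<open>v L < 0\<close>; at \<open>r\<close> the slope is negative, so
  \<open>v L = 0\<close> forces a next extremum \<open>p'\<close>. The two quarter-wave bounds are
  added. The lower bound on \<open>p' - p\<close> makes the later iteration over half waves
  stop.\<close>

lemma half_wave_pos:
  fixes \<omega> p L d Q :: real
  assumes \<omega>: "\<omega> > 0" and "p < L" and d: "0 \<le> d" "d < pi / 2"
    and u: "primitive_on p L u v" and v: "primitive_on p L v (\<lambda>x. - ((\<omega>\<^sup>2 + q x) * u x))"
    and q: "q absolutely_integrable_on {p..L}" "\<And>x. x \<in> {p..L} \<Longrightarrow> 0 \<le> q x"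
    and bd: "v p = 0" "v L = 0" and up: "u p > 0" and Q: "0 < Q" "integral {p..L} q \<le> Q"
  shows "\<exists>p'. p < p' \<and> p' \<le> L \<and> v p' = 0 \<and> u p' \<noteq> 0 \<and>
    min (pi / (3 * \<omega>)) (1 / (2 * Q)) \<le> p' - p \<and>
    \<omega> * (p' - p) \<le> pi \<and> \<omega> * (wave_gain d - \<omega> * (p' - p) / (cos d)\<^sup>2) \<le> integral {p..p'} q \<and>
    (0 < integral {p..p'} q \<longrightarrow> \<omega> * (p' - p) < pi \<and>
      \<omega> * (wave_gain d - \<omega> * (p' - p) / (cos d)\<^sup>2) < integral {p..p'} q)"
proof -
  note cu = primitive_on_continuous[OF u] and cv = primitive_on_continuous[OF v]
  have w2: "\<omega>\<^sup>2 > 0" using \<omega> by simp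
  have "\<exists>z\<in>{p..L}. u z = 0"
  proof (rule ccontr)
    assume nz: "\<not> (\<exists>z\<in>{p..L}. u z = 0)"
    have pos: "u x > 0" if x: "x \<in> {p..L}" for x
    proof (rule ccontr)
      assume "\<not> u x > 0"
      then obtain y where "p \<le> y" "y \<le> x" "u y = 0"
        using IVT2'[of u x 0 p] x up continuous_on_subset[OF cu, of "{p..x}"] by auto
      then show False using nz x by auto
    qed
    then have "v L < 0"
      using slope_neg[OF w2 \<open>p < L\<close> u v q bd(1)] by (auto simp: less_imp_le)
    then show False using bd by simp
  qed
  then obtain z where "z \<in> {p..L}" "u z = 0" by blast
  then obtain r where r: "p < r" "r \<le> L" "u r = 0" "\<And>x. x \<in> {p..<r} \<Longrightarrow> u x > 0"
    using first_zero[OF cu up] by metis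
  have sub1: "primitive_on p r u v" "primitive_on p r v (\<lambda>x. - ((\<omega>\<^sup>2 + q x) * u x))"
    "q absolutely_integrable_on {p..r}" "\<And>x. x \<in> {p..r} \<Longrightarrow> 0 \<le> q x"
    using primitive_on_subinterval[OF u, of p r] primitive_on_subinterval[OF v, of p r] r q
      absolutely_integrable_on_subinterval[OF q(1), of p r] by auto
  have vr: "v r < 0"
  proof (rule slope_neg[OF w2 r(1) sub1 bd(1) _ r(4)])
    show "u x \<ge> 0" if "x \<in> {p..r}" for x
      using that r(3) r(4)[of x] by (cases "x = r") (auto simp: less_imp_le)
  qed auto
  have "r < L" using vr bd r(2) by (cases "r = L") auto
  have "continuous_on {r..L} (\<lambda>x. - v x)"
    using continuous_on_subset[OF cv, of "{r..L}"] r by (intro continuous_intros) auto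
  then obtain p' where p': "r < p'" "p' \<le> L" "v p' = 0" "\<And>x. x \<in> {r..<p'} \<Longrightarrow> v x < 0"
    using first_zero[of r L "\<lambda>x. - v x" L] vr bd \<open>r < L\<close> by auto
  have uneg: "u x < 0" if "x \<in> {r<..p'}" for x
  proof -
    have "0 < integral {r..x} (\<lambda>t. - v t * 1)"
    proof (rule integral_continuous_mult_pos)
      show "(\<lambda>t. 1::real) absolutely_integrable_on {r..x}" by (intro absolutely_integrable_continuous_real) auto
      show "continuous_on {r..x} (\<lambda>t. - v t)"
        using continuous_on_subset[OF cv, of "{r..x}"] r p' that by (intro continuous_intros) auto
      show "0 \<le> - v t" if "t \<in> {r..x}" for t
        using p'(3) p'(4)[of t] that \<open>x \<in> {r<..p'}\<close> by (cases "t = p'") (auto simp: less_imp_le)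
      show "0 < - v t" if "t \<in> {r<..<x}" for t
        using p'(4)[of t] that \<open>x \<in> {r<..p'}\<close> by auto
    qed (use that in auto)
    moreover have "(v has_integral u x - u r) {r..x}"
      using r p' that by (intro primitive_onD(2)[OF u]) auto
    ultimately show ?thesis using r(3) by (auto dest!: integral_unique)
  qed
  have sub2: "primitive_on r p' u v" "primitive_on r p' v (\<lambda>x. - ((\<omega>\<^sup>2 + q x) * u x))"
    "q absolutely_integrable_on {r..p'}" "\<And>x. x \<in> {r..p'} \<Longrightarrow> 0 \<le> q x"
    using primitive_on_subinterval[OF u, of r p'] primitive_on_subinterval[OF v, of r p'] r p' q
      absolutely_integrable_on_subinterval[OF q(1), of r p'] by auto
  define K1 K2 where "K1 = integral {p..r} q" and "K2 = integral {r..p'} q"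
  have qi: "q integrable_on {p..L}" using q(1) set_lebesgue_integral_eq_integral(1) by blast
  have K: "integral {p..p'} q = K1 + K2"
    unfolding K1_def K2_def 
    using Henstock_Kurzweil_Integration.integral_combine[of p r p' q] r p' integrable_on_subinterval[OF qi, of p p'] by auto
  have K0: "K1 \<ge> 0" "K2 \<ge> 0"
    unfolding K1_def K2_def using sub1 sub2 
    by (auto intro!: Henstock_Kurzweil_Integration.integral_nonneg set_lebesgue_integral_eq_integral(1))
  have "K1 \<le> integral {p..L} q"
    unfolding K1_def using r q qi integrable_on_subinterval[OF qi, of p r] by (intro integral_subset_le) auto
  then have K1Q: "K1 \<le> Q" using Q by simp
  have q1: "\<omega> * (r - p) \<le> pi / 2"
    "\<omega> * cos (\<omega> * (r - p)) \<le> K1 * sin (\<omega> * (r - p))"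
    "\<omega> * (tan d + (pi / 2 - \<omega> * (r - p) - d) / (cos d)\<^sup>2) \<le> K1"
    "K1 > 0 \<Longrightarrow> \<omega> * (r - p) < pi / 2"
    "K1 > 0 \<Longrightarrow> \<omega> * (tan d + (pi / 2 - \<omega> * (r - p) - d) / (cos d)\<^sup>2) < K1"
    by (rule quarter_wave[OF \<omega> r(1) d sub1 bd(1) r(3,4), folded K1_def]; assumption)+
  \<comment> \<open>Read backwards and with changed sign, the negative arc from \<open>r\<close> to
    \<open>p'\<close> becomes a positive arc that starts at an extremum and ends at a zero.\<close>
  have ref: "primitive_on (- p') (- r) (\<lambda>x. - u (- x)) (\<lambda>x. v (- x))"
    "primitive_on (- p') (- r) (\<lambda>x. v (- x)) (\<lambda>x. - ((\<omega>\<^sup>2 + q (- x)) * (- u (- x))))"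
    "(\<lambda>x. q (- x)) absolutely_integrable_on {- p'..- r}"
    using primitive_on_reflect[OF sub2(1)] primitive_on_uminus[OF primitive_on_reflect[OF sub2(2)]] sub2(3) 
    by simp_all
  have neg: "- p' < - r" "v (- (- p')) = 0" "- u (- (- r)) = 0"
    "\<And>x. x \<in> {- p'..- r} \<Longrightarrow> 0 \<le> q (- x)" "\<And>x. x \<in> {- p'..<- r} \<Longrightarrow> - u (- x) > 0"
    using p' r(3) uneg sub2(4) by auto
  have IK: "integral {- p'..- r} (\<lambda>x. q (- x)) = K2" and len2: "- r - - p' = p' - r" by (simp_all add: K2_def)
  have q2: "\<omega> * (p' - r) \<le> pi / 2"
    "\<omega> * (tan d + (pi / 2 - \<omega> * (p' - r) - d) / (cos d)\<^sup>2) \<le> K2"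
    "K2 > 0 \<Longrightarrow> \<omega> * (p' - r) < pi / 2"
    "K2 > 0 \<Longrightarrow> \<omega> * (tan d + (pi / 2 - \<omega> * (p' - r) - d) / (cos d)\<^sup>2) < K2"
    by (rule quarter_wave[OF \<omega> neg(1) d ref neg(4) neg(2,3,5), unfolded len2 IK]; assumption)+
  have sum: "\<omega> * (wave_gain d - \<omega> * (p' - p) / (cos d)\<^sup>2) =
     \<omega> * (tan d + (pi / 2 - \<omega> * (r - p) - d) / (cos d)\<^sup>2) + \<omega> * (tan d + (pi / 2 - \<omega> * (p' - r) - d) / (cos d)\<^sup>2)"
    unfolding wave_gain_def by (simp add: add_divide_distrib diff_divide_distrib algebra_simps)
  have sum2: "\<omega> * (p' - p) = \<omega> * (r - p) + \<omega> * (p' - r)" by (simp add: algebra_simps)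
  \<comment> \<open>For a phase below \<open>\<pi>/3\<close> the cosine is at least
    \<open>1/2\<close>, so the cotangent bound together with \<open>sin x \<le> x\<close> and
    \<open>K1 \<le> Q\<close> gives \<open>1/2 \<le> Q (r - p)\<close>: a short quarter wave costs
    more mass than there is.\<close>
  have "min (pi / (3 * \<omega>)) (1 / (2 * Q)) \<le> r - p"
  proof (rule ccontr)
    assume "\<not> ?thesis"
    then have s: "r - p < pi / (3 * \<omega>)" "r - p < 1 / (2 * Q)" by auto
    have a: "\<omega> * (r - p) < pi / 3" using s(1) \<omega> by (simp add: field_simps)
    have "cos (pi / 3) \<le> cos (\<omega> * (r - p))"
      using a \<omega> r(1) by (intro cos_monotone_0_pi_le) auto
    then have "\<omega> * (1 / 2) \<le> \<omega> * cos (\<omega> * (r - p))" using \<omega> by (intro mult_left_mono) (auto simp: cos_60)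
    also have "\<dots> \<le> K1 * sin (\<omega> * (r - p))" by (rule q1(2))
    also have "\<dots> \<le> Q * (\<omega> * (r - p))"
    proof (intro mult_mono sin_x_le_x sin_ge_zero)
      show "\<omega> * (r - p) \<le> pi" using q1(1) pi_ge_zero by linarith
    qed (use K1Q \<omega> r(1) Q in auto)
    finally have "\<omega> * (1 / 2) \<le> \<omega> * (Q * (r - p))" by (simp only: mult.left_commute)
    then have "1 / 2 \<le> Q * (r - p)" using \<omega> mult_le_cancel_left_pos by blast
    then show False using s(2) Q by (simp add: field_simps)
  qed
  then have len: "min (pi / (3 * \<omega>)) (1 / (2 * Q)) \<le> p' - p" using p' by linarith
  show ?thesis
  proof (intro exI[of _ p'] conjI impI)
    show "u p' \<noteq> 0" using uneg[of p'] p' by auto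
    assume "0 < integral {p..p'} q"
    then have or: "K1 > 0 \<or> K2 > 0" unfolding K using K0 by linarith
    show "\<omega> * (p' - p) < pi"
      unfolding sum2 using or
    proof
      assume "K1 > 0"
      from q1(4)[OF this] q2(1) show "\<omega> * (r - p) + \<omega> * (p' - r) < pi" by linarith
    next
      assume "K2 > 0"
      from q2(3)[OF this] q1(1) show "\<omega> * (r - p) + \<omega> * (p' - r) < pi" by linarith
    qed
    show "\<omega> * (wave_gain d - \<omega> * (p' - p) / (cos d)\<^sup>2) < integral {p..p'} q"
      unfolding sum K using or
    proof
      assume "K1 > 0"
      from add_less_le_mono[OF q1(5)[OF this] q2(2)] show "\<omega> * (tan d + (pi / 2 - \<omega> * (r - p) - d) / (cos d)\<^sup>2) + \<omega> * (tan d + (pi / 2 - \<omega> * (p' - r) - d) / (cos d)\<^sup>2) < K1 + K2" .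
    next
      assume "K2 > 0"
      from add_le_less_mono[OF q1(3) q2(4)[OF this]] show "\<omega> * (tan d + (pi / 2 - \<omega> * (r - p) - d) / (cos d)\<^sup>2) + \<omega> * (tan d + (pi / 2 - \<omega> * (p' - r) - d) / (cos d)\<^sup>2) < K1 + K2" .
    qed
  next
    show "p < p'" using p'(1) r(1) by linarith
    show "\<omega> * (p' - p) \<le> pi" using q1(1) q2(1) unfolding sum2 by linarith
    show "\<omega> * (wave_gain d - \<omega> * (p' - p) / (cos d)\<^sup>2) \<le> integral {p..p'} q"
      unfolding sum K by (rule add_mono[OF q1(3) q2(2)])
  qed (fact p'(2) p'(3) len)+
qed

lemma half_wave:
  fixes \<omega> p L d Q :: real
  assumes "\<omega> > 0" and "p < L" and "0 \<le> d" "d < pi / 2"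
    and u: "primitive_on p L u v" and v: "primitive_on p L v (\<lambda>x. - ((\<omega>\<^sup>2 + q x) * u x))"
    and "q absolutely_integrable_on {p..L}" "\<And>x. x \<in> {p..L} \<Longrightarrow> 0 \<le> q x"
    and bd: "v p = 0" "v L = 0" and up: "u p \<noteq> 0" and Q: "0 < Q" "integral {p..L} q \<le> Q"
  shows "\<exists>p'. p < p' \<and> p' \<le> L \<and> v p' = 0 \<and> u p' \<noteq> 0 \<and>
    min (pi / (3 * \<omega>)) (1 / (2 * Q)) \<le> p' - p \<and>
    \<omega> * (p' - p) \<le> pi \<and> \<omega> * (wave_gain d - \<omega> * (p' - p) / (cos d)\<^sup>2) \<le> integral {p..p'} q \<and>
    (0 < integral {p..p'} q \<longrightarrow> \<omega> * (p' - p) < pi \<and>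
      \<omega> * (wave_gain d - \<omega> * (p' - p) / (cos d)\<^sup>2) < integral {p..p'} q)"
proof (cases "u p > 0")
  case True
  show ?thesis by (rule half_wave_pos[OF assms(1-10) True Q])
next
  case False
  then have up': "- u p > 0" using up by simp
  have "primitive_on p L (\<lambda>x. - v x) (\<lambda>x. - ((\<omega>\<^sup>2 + q x) * - u x))"
    using primitive_on_uminus[OF v] by simp
  moreover have "- v p = 0" "- v L = 0" using bd by simp_all
  ultimately show ?thesis
    using half_wave_pos[OF assms(1-4) primitive_on_uminus[OF u] _ assms(7,8) _ _ up' Q]
    by (simp only: neg_equal_0_iff_equal)
qed

text \<open>Half waves are split off one after another until \<open>L\<close> is reached. Each has
  length at least \<open>h\<close>, which depends only on \<open>\<omega>\<close> and the total
  mass, so finitely many suffice; \<open>m\<close> is their number.\<close>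

lemma wave_count:
  fixes \<omega> p L d :: real
  assumes "\<omega> > 0" and d: "0 \<le> d" "d < pi / 2" and "p < L"
    and "primitive_on p L u v" "primitive_on p L v (\<lambda>x. - ((\<omega>\<^sup>2 + q x) * u x))"
    and "q absolutely_integrable_on {p..L}" "\<And>x. x \<in> {p..L} \<Longrightarrow> 0 \<le> q x"
    and "v p = 0" "v L = 0" "u p \<noteq> 0" "integral {p..L} q > 0"
  shows "\<exists>m::nat. \<omega> * (L - p) < real m * pi \<and>
    \<omega> * (real m * wave_gain d - \<omega> * (L - p) / (cos d)\<^sup>2) < integral {p..L} q"
proof -
  define Q where "Q = integral {p..L} q"
  define h where "h = min (pi / (3 * \<omega>)) (1 / (2 * Q))"
  have Q: "Q > 0" using assms by (simp add: Q_def)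
  have h: "h > 0" using Q assms by (simp add: h_def)
  \<comment> \<open>The weak inequalities have to be carried along because \<open>q\<close> may
    vanish on some of the half waves; the strict ones are claimed only if mass remains. The index
    \<open>k\<close> bounds how many further half waves fit.\<close>
  have main: "L - s \<le> real k * h \<Longrightarrow> p \<le> s \<Longrightarrow> s \<le> L \<Longrightarrow> v s = 0 \<Longrightarrow> u s \<noteq> 0 \<Longrightarrow> \<exists>m::nat. 
      \<omega> * (L - s) \<le> real m * pi \<and>
      \<omega> * (real m * wave_gain d - \<omega> * (L - s) / (cos d)\<^sup>2) \<le> integral {s..L} q \<and>
      (0 < integral {s..L} q \<longrightarrow> \<omega> * (L - s) < real m * pi \<and>
      \<omega> * (real m * wave_gain d - \<omega> * (L - s) / (cos d)\<^sup>2) < integral {s..L} q)" for k s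
  proof (induction k arbitrary: s)
    case 0
    then show ?case by (intro exI[of _ 0]) auto
  next
    case (Suc k)
    show ?case
    proof (cases "s = L")
      case True
      then show ?thesis by (intro exI[of _ 0]) auto
    next
      case False
      then have "s < L" using Suc by simp
      have sub: "primitive_on s L u v" "primitive_on s L v (\<lambda>x. - ((\<omega>\<^sup>2 + q x) * u x))"
        "q absolutely_integrable_on {s..L}" "\<And>x. x \<in> {s..L} \<Longrightarrow> 0 \<le> q x"
        using primitive_on_subinterval[OF assms(5), of s L] primitive_on_subinterval[OF assms(6), of s L] Suc.prems assms(8)
          absolutely_integrable_on_subinterval[OF assms(7), of s L] by auto
      have qi: "q integrable_on {p..L}" "q integrable_on {s..L}"
        using assms(7) sub(3) set_lebesgue_integral_eq_integral(1) by blast+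
      have Qs: "integral {s..L} q \<le> Q"
        unfolding Q_def using Suc.prems assms qi by (intro integral_subset_le) auto
      obtain t where t: "s < t" "t \<le> L" "v t = 0" "u t \<noteq> 0" "h \<le> t - s"
        "\<omega> * (t - s) \<le> pi" "\<omega> * (wave_gain d - \<omega> * (t - s) / (cos d)\<^sup>2) \<le> integral {s..t} q"
        "0 < integral {s..t} q \<Longrightarrow> \<omega> * (t - s) < pi"
        "0 < integral {s..t} q \<Longrightarrow> \<omega> * (wave_gain d - \<omega> * (t - s) / (cos d)\<^sup>2) < integral {s..t} q"
        by (rule exE[OF half_wave[OF assms(1) \<open>s < L\<close> d sub Suc.prems(4) assms(10) Suc.prems(5) Q Qs, folded h_def]],
            assumption) blast
      have "L - t \<le> real k * h" using Suc.prems(1) t(5) by (simp add: algebra_simps)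
      then obtain m where m: "\<omega> * (L - t) \<le> real m * pi"
        "\<omega> * (real m * wave_gain d - \<omega> * (L - t) / (cos d)\<^sup>2) \<le> integral {t..L} q"
        "0 < integral {t..L} q \<Longrightarrow> \<omega> * (L - t) < real m * pi"
        "0 < integral {t..L} q \<Longrightarrow> \<omega> * (real m * wave_gain d - \<omega> * (L - t) / (cos d)\<^sup>2) < integral {t..L} q"
        using Suc.IH[of t] t Suc.prems by auto
      have I: "integral {s..L} q = integral {s..t} q + integral {t..L} q"
        using Henstock_Kurzweil_Integration.integral_combine[of s t L q] t qi by auto
      have I0: "integral {s..t} q \<ge> 0" "integral {t..L} q \<ge> 0"
        using t sub(4) integrable_on_subinterval[OF qi(2), of s t] integrable_on_subinterval[OF qi(2), of t L]
        by (auto intro!: Henstock_Kurzweil_Integration.integral_nonneg)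
      have e1: "\<omega> * (L - s) = \<omega> * (t - s) + \<omega> * (L - t)" "real (Suc m) * pi = pi + real m * pi"
        by (simp_all add: algebra_simps)
      have e2: "\<omega> * (real (Suc m) * wave_gain d - \<omega> * (L - s) / (cos d)\<^sup>2) = 
         \<omega> * (wave_gain d - \<omega> * (t - s) / (cos d)\<^sup>2) + \<omega> * (real m * wave_gain d - \<omega> * (L - t) / (cos d)\<^sup>2)"
        by (simp add: add_divide_distrib diff_divide_distrib algebra_simps)
      show ?thesis
      proof (intro exI[of _ "Suc m"] conjI impI)
        assume "0 < integral {s..L} q"
        \<comment> \<open>Positive mass lies in the first half wave or in the rest, and one strict
          summand is enough.\<close>
        then consider "0 < integral {s..t} q" | "0 < integral {t..L} q" using I I0 by linarith
        then have "\<omega> * (L - s) < real (Suc m) * pi \<and>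
          \<omega> * (real (Suc m) * wave_gain d - \<omega> * (L - s) / (cos d)\<^sup>2) < integral {s..L} q"
        proof cases
          case 1
          show ?thesis
            unfolding e2 I unfolding e1 using add_less_le_mono[OF t(8)[OF 1] m(1)] add_less_le_mono[OF t(9)[OF 1] m(2)]
            by blast
        next
          case 2
          show ?thesis
            unfolding e2 I unfolding e1 using add_le_less_mono[OF t(6) m(3)[OF 2]] add_le_less_mono[OF t(7) m(4)[OF 2]]
            by blast
        qed
        then show "\<omega> * (L - s) < real (Suc m) * pi"
          "\<omega> * (real (Suc m) * wave_gain d - \<omega> * (L - s) / (cos d)\<^sup>2) < integral {s..L} q" by blast+
      next
        show "\<omega> * (L - s) \<le> real (Suc m) * pi" unfolding e1 by (rule add_mono[OF t(6) m(1)])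
        show "\<omega> * (real (Suc m) * wave_gain d - \<omega> * (L - s) / (cos d)\<^sup>2) \<le> integral {s..L} q"
          unfolding e2 I by (rule add_mono[OF t(7) m(2)])
      qed
    qed
  qed
  obtain k :: nat where "(L - p) / h \<le> real k" using real_arch_simple by blast
  then have "L - p \<le> real k * h" using h by (simp add: field_simps)
  from main[OF this order_refl less_imp_le[OF \<open>p < L\<close>] assms(9,11)] assms(12) show ?thesis by blast
qed

section \<open>Uniqueness for the linear equation with an integrable coefficient\<close>

lemma ode_unique_step:
  fixes c :: "real \<Rightarrow> real"
  assumes "a \<le> b" and u: "primitive_on a b u v" and v: "primitive_on a b v (\<lambda>x. - (c x * u x))"
    and c: "c absolutely_integrable_on {a..b}" "(b - a) * integral {a..b} (\<lambda>x. \<bar>c x\<bar>) < 1"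
    and z: "u a = 0" "v a = 0" and x: "x \<in> {a..b}"
  shows "u x = 0" "v x = 0"
proof -
  define C where "C = integral {a..b} (\<lambda>x. \<bar>c x\<bar>)"
  have "\<exists>x0\<in>{a..b}. \<forall>y\<in>{a..b}. \<bar>u y\<bar> \<le> \<bar>u x0\<bar>"
    using \<open>a \<le> b\<close> primitive_on_continuous[OF u]
    by (intro continuous_attains_sup continuous_intros) auto
  then obtain x0 where x0: "x0 \<in> {a..b}" "\<And>y. y \<in> {a..b} \<Longrightarrow> \<bar>u y\<bar> \<le> \<bar>u x0\<bar>" by blast
  have ci: "(\<lambda>x. \<bar>c x\<bar>) integrable_on {a..b}" using c(1) by (auto simp: absolutely_integrable_on_def)
  have vb: "\<bar>v t\<bar> \<le> \<bar>u x0\<bar> * C" if t: "t \<in> {a..b}" for t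
  proof -
    have ct: "c absolutely_integrable_on {a..t}"
      using t by (intro absolutely_integrable_on_subinterval[OF c(1)]) auto
    have hi: "((\<lambda>x. - (c x * u x)) has_integral v t - v a) {a..t}"
      using t by (intro primitive_onD(2)[OF v]) auto
    then have hi': "((\<lambda>x. (- u x) * c x) has_integral v t) {a..t}" using z by (simp add: mult.commute)
    have "\<bar>integral {a..t} (\<lambda>x. (- u x) * c x)\<bar> \<le> \<bar>u x0\<bar> * integral {a..t} (\<lambda>x. \<bar>c x\<bar>)"
      using x0 t by (intro integral_abs_le_mult has_integral_integrable[OF hi'] ct) auto
    also have "\<dots> \<le> \<bar>u x0\<bar> * C"
      unfolding C_def using t ci
      by (intro mult_left_mono integral_subset_le integrable_on_subinterval[OF ci]) auto
    finally show ?thesis using integral_unique[OF hi'] by simp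
  qed
  have "\<bar>u x0\<bar> \<le> (\<bar>u x0\<bar> * C) * (x0 - a)"
  proof -
    have h: "(v has_integral u x0) {a..x0}" using primitive_onD(2)[OF u order_refl, of x0] x0 z by auto
    have "norm (u x0) \<le> (\<bar>u x0\<bar> * C) * measure lborel {a..x0}"
      using vb x0 Henstock_Kurzweil_Integration.integral_nonneg[OF ci]
      by (intro has_integral_bound_real[OF _ finite.emptyI h]) (auto simp: C_def)
    then show ?thesis using x0 by simp
  qed
  also have "\<dots> \<le> \<bar>u x0\<bar> * (C * (b - a))"
    using x0 Henstock_Kurzweil_Integration.integral_nonneg[OF ci] by (auto simp: C_def mult.assoc intro!: mult_left_mono)
  \<comment> \<open>The maximum of \<open>\<bar>u\<bar>\<close> is at most itself times a factor
    below \<open>1\<close>, hence it is \<open>0\<close>.\<close>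
  finally have "\<bar>u x0\<bar> \<le> \<bar>u x0\<bar> * (C * (b - a))" .
  moreover have "C * (b - a) < 1" using c(2) by (simp add: C_def mult.commute)
  ultimately have "u x0 = 0"
    by (metis abs_ge_zero abs_eq_0 less_eq_real_def mult.right_neutral mult_less_cancel_left_pos not_le)
  then show "u x = 0" "v x = 0" using x0 vb x by fastforce+
qed

text \<open>Zero data are propagated in steps of length \<open>h\<close>. With
  \<open>h = 1 / (C + 1)\<close> the product of step length and coefficient mass is at most
  \<open>h C < 1\<close>, whatever the position of the step. A nontrivial Neumann solution therefore
  cannot vanish at \<open>0\<close>.\<close>

lemma ode_unique:
  fixes c :: "real \<Rightarrow> real"
  assumes u: "primitive_on a b u v" and v: "primitive_on a b v (\<lambda>x. - (c x * u x))"
    and c: "c absolutely_integrable_on {a..b}"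
    and z: "u a = 0" "v a = 0" and x: "x \<in> {a..b}"
  shows "u x = 0"
proof -
  define C where "C = integral {a..b} (\<lambda>x. \<bar>c x\<bar>)"
  have ci: "(\<lambda>x. \<bar>c x\<bar>) integrable_on {a..b}" using c(1) by (auto simp: absolutely_integrable_on_def)
  have C0: "C \<ge> 0" unfolding C_def using Henstock_Kurzweil_Integration.integral_nonneg[OF ci] by auto
  define h where "h = 1 / (C + 1)"
  have h: "h > 0" "h * C < 1" using C0 by (auto simp: h_def field_simps)
  have step: "u y = 0 \<and> v y = 0" if "s \<in> {a..b}" "u s = 0" "v s = 0" "y \<in> {s..min b (s + h)}" for s y
  proof -
    let ?b = "min b (s + h)"
    have sub: "a \<le> s" "?b \<le> b" "s \<le> ?b" using that h by auto
    have "(?b - s) * integral {s..?b} (\<lambda>x. \<bar>c x\<bar>) \<le> h * C"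
      unfolding C_def using sub ci h
      by (intro mult_mono integral_subset_le integrable_on_subinterval[OF ci]
           Henstock_Kurzweil_Integration.integral_nonneg) auto
    then have "(?b - s) * integral {s..?b} (\<lambda>x. \<bar>c x\<bar>) < 1" using h by linarith
    from ode_unique_step[OF sub(3) primitive_on_subinterval[OF u sub(1,2)] primitive_on_subinterval[OF v sub(1,2)]
        absolutely_integrable_on_subinterval[OF c] this that(2,3,4)] sub
    show ?thesis by auto
  qed
  have "\<forall>y\<in>{a..min b (a + real k * h)}. u y = 0 \<and> v y = 0" for k
  proof (induction k)
    case 0
    then show ?case using z by auto
  next
    case (Suc k)
    show ?case
    proof
      fix y assume y: "y \<in> {a..min b (a + real (Suc k) * h)}"
      define s where "s = min b (a + real k * h)"
      show "u y = 0 \<and> v y = 0"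
      proof (cases "y \<le> s")
        case True
        then show ?thesis using Suc y by (auto simp: s_def)
      next
        case False
        have s: "s \<in> {a..min b (a + real k * h)}" using y h by (auto simp: s_def)
        show ?thesis
          using Suc s y False by (intro step[of s]) (auto simp: s_def algebra_simps)
      qed
    qed
  qed
  moreover obtain k :: nat where "(b - a) / h \<le> real k" using real_arch_simple by blast
  then have "b \<le> a + real k * h" using h by (simp add: field_simps)
  ultimately show ?thesis using x by (metis min.absorb1)
qed

lemma neumann_integral_lower_bound:
  fixes L :: real and n :: nat
  defines "\<omega> \<equiv> real n * pi / L"
  assumes L: "L > 0" and n: "n \<ge> 1"
    and u: "primitive_on 0 L u v" and v: "primitive_on 0 L v (\<lambda>x. - ((\<omega>\<^sup>2 + q x) * u x))"
    and q: "q absolutely_integrable_on {0..L}" "\<And>x. x \<in> {0..L} \<Longrightarrow> 0 \<le> q x" "integral {0..L} q > 0"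
    and bd: "v 0 = 0" "v L = 0" "u 0 \<noteq> 0"
  shows "2 * pi * real n * (real n + 1) / L * cot (pi * real n / (2 * (real n + 1))) < integral {0..L} q"
proof -
  \<comment> \<open>With \<open>n + 1\<close> equal half waves each quarter wave has phase
    \<open>n \<pi> / (2 (n + 1))\<close>, and \<open>d\<close> is its complement to
    \<open>\<pi>/2\<close>. This turns the cotangent of the claim into \<open>tan d\<close>.\<close>
  define d where "d = pi / (2 * (real n + 1))"
  have w: "\<omega> > 0" "\<omega> * L = real n * pi" using L n by (auto simp: \<omega>_def)
  have d: "0 \<le> d" "d < pi / 2" "2 * (real n + 1) * d = pi"
    using n by (auto simp: d_def field_simps)
  have cd: "cos d > 0" using d cos_gt_zero_pi[of d] by auto
  have td: "tan d \<ge> 0" using d cd sin_ge_zero[of d] by (simp add: tan_def)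
  obtain m where m: "\<omega> * (L - 0) < real m * pi"
    "\<omega> * (real m * wave_gain d - \<omega> * (L - 0) / (cos d)\<^sup>2) < integral {0..L} q"
    using wave_count[OF w(1) d(1,2) L u v q(1) _ bd q(3)] q(2) by blast
  have "real n * pi < real m * pi" using m(1) w by simp
  then have "real n < real m" by simp
  then have mn: "real m \<ge> real n + 1" by (simp flip: of_nat_Suc add: add.commute)
  have gain: "wave_gain d \<ge> 0" unfolding wave_gain_def using d td by auto
  \<comment> \<open>The coefficient of \<open>1 / (cos d)\<^sup>2\<close> is
    \<open>\<pi> - 2 (n + 1) d\<close>, which vanishes by the choice of \<open>d\<close>.\<close>
  have "(real n + 1) * wave_gain d - real n * pi / (cos d)\<^sup>2 = 2 * (real n + 1) * tan d"
  proof -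
    have "(real n + 1) * wave_gain d - real n * pi / (cos d)\<^sup>2 =
       2 * (real n + 1) * tan d + (pi - 2 * (real n + 1) * d) / (cos d)\<^sup>2"
      unfolding wave_gain_def using cd by (simp add: divide_simps) (simp add: algebra_simps)
    then show ?thesis using d(3) by simp
  qed
  then have "2 * (real n + 1) * tan d \<le> real m * wave_gain d - real n * pi / (cos d)\<^sup>2"
    using mult_right_mono[OF mn gain] by linarith
  then have "\<omega> * (2 * (real n + 1) * tan d) \<le> \<omega> * (real m * wave_gain d - \<omega> * (L - 0) / (cos d)\<^sup>2)"
    using w by (intro mult_left_mono) auto
  moreover have "tan d = cot (pi * real n / (2 * (real n + 1)))"
  proof -
    have "pi * real n / (2 * (real n + 1)) = pi / 2 - d" by (simp add: d_def field_simps)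
    then show ?thesis by (simp add: cot_def tan_def sin_diff cos_diff)
  qed
  moreover have "2 * pi * real n * (real n + 1) / L * t = \<omega> * (2 * (real n + 1) * t)" for t
    by (simp add: \<omega>_def)
  ultimately show ?thesis using m(2) by simp
qed

section \<open>Test functions and weak derivatives\<close>

definition smooth :: "(real \<Rightarrow> real) \<Rightarrow> bool" where
  "smooth f \<longleftrightarrow> (\<forall>k x. (deriv ^^ k) f differentiable (at x))"

text \<open>A family closed under differentiation contains all iterated derivatives of its members,
  so no formula for higher derivatives is needed.\<close>

lemma smooth_coinduct:
  assumes "f \<in> S" and step: "\<And>g. g \<in> S \<Longrightarrow> \<exists>g'\<in>S. \<forall>x. (g has_real_derivative g' x) (at x)"
  shows "smooth f"
proof -
  have "(deriv ^^ k) f \<in> S" for k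
  proof (induction k)
    case (Suc k)
    then obtain g' where g': "g' \<in> S" "\<And>x. ((deriv ^^ k) f has_real_derivative g' x) (at x)"
      using step by blast
    then have "deriv ((deriv ^^ k) f) = g'" by (auto intro: DERIV_imp_deriv)
    then show ?case using g' by simp
  qed (use assms in simp)
  then show ?thesis
    unfolding smooth_def using step by (meson real_differentiable_def)
qed

lemma smooth_deriv:
  assumes "smooth f"
  shows "smooth (deriv f)" "(f has_real_derivative deriv f x) (at x)"
proof -
  have "(deriv ^^ k) (deriv f) differentiable (at x)" for k x
    using assms[unfolded smooth_def, rule_format, of "Suc k" x] by (simp add: funpow_swap1)
  then show "smooth (deriv f)" by (simp add: smooth_def)
  have "(deriv ^^ 0) f differentiable (at x)" using assms unfolding smooth_def by blast
  then show "(f has_real_derivative deriv f x) (at x)"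
    using DERIV_deriv_iff_real_differentiable by auto
qed

lemma smooth_continuous_on: "smooth f \<Longrightarrow> continuous_on A f"
  by (meson DERIV_continuous_on has_field_derivative_at_within smooth_deriv(2))

lemma smooth_antiderivative:
  assumes "smooth f" "\<And>x. (F has_real_derivative f x) (at x)"
  shows "smooth F"
proof (rule smooth_coinduct[of F "insert F (Collect smooth)"])
  fix g assume "g \<in> insert F (Collect smooth)"
  then show "\<exists>g'\<in>insert F (Collect smooth). \<forall>x. (g has_real_derivative g' x) (at x)"
    using assms smooth_deriv by blast
qed simp

lemma smooth_affine:
  assumes "smooth f"
  shows "smooth (\<lambda>x. c * f (a * x + b))"
proof (rule smooth_coinduct[of _ "{\<lambda>x. c * f (a * x + b) |c f. smooth f}"])
  fix g assume "g \<in> {\<lambda>x. c * f (a * x + b) |c f. smooth f}"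
  then obtain c f where g: "g = (\<lambda>x. c * f (a * x + b))" "smooth f" by blast
  have "((\<lambda>x. c * f (a * x + b)) has_real_derivative c * a * deriv f (a * x + b)) (at x)" for x
    by (auto intro!: derivative_eq_intros DERIV_chain2[OF smooth_deriv(2)[OF g(2)]])
  then show "\<exists>g'\<in>{\<lambda>x. c * f (a * x + b) |c f. smooth f}. \<forall>x. (g has_real_derivative g' x) (at x)"
    using g smooth_deriv(1)[OF g(2)] by (intro bexI[of _ "\<lambda>x. c * a * deriv f (a * x + b)"]) blast+
qed (use assms in blast)

lemma smooth_diff:
  assumes "smooth f" "smooth g"
  shows "smooth (\<lambda>x. f x - g x)"
proof (rule smooth_coinduct[of _ "{\<lambda>x. f x - g x |f g. smooth f \<and> smooth g}"])
  fix h assume "h \<in> {\<lambda>x. f x - g x |f g. smooth f \<and> smooth g}"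
  then obtain f g where h: "h = (\<lambda>x. f x - g x)" "smooth f" "smooth g" by blast
  have "((\<lambda>x. f x - g x) has_real_derivative deriv f x - deriv g x) (at x)" for x
    by (auto intro!: derivative_eq_intros smooth_deriv(2) h)
  then show "\<exists>h'\<in>{\<lambda>x. f x - g x |f g. smooth f \<and> smooth g}. \<forall>x. (h has_real_derivative h' x) (at x)"
    using h smooth_deriv(1) by (intro bexI[of _ "\<lambda>x. deriv f x - deriv g x"]) blast+
qed (use assms in blast)

text \<open>By the Leibniz rule the derivative of a product is a sum of two products; closing under
  sums gives a family stable under differentiation.\<close>

inductive_set product_sums :: "(real \<Rightarrow> real) set" where
  base: "smooth f \<Longrightarrow> smooth g \<Longrightarrow> (\<lambda>x. f x * g x) \<in> product_sums"
| add: "f \<in> product_sums \<Longrightarrow> g \<in> product_sums \<Longrightarrow> (\<lambda>x. f x + g x) \<in> product_sums"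

lemma smooth_mult:
  assumes "smooth f" "smooth g"
  shows "smooth (\<lambda>x. f x * g x)"
proof (rule smooth_coinduct[of _ product_sums])
  fix h assume "h \<in> product_sums"
  then show "\<exists>h'\<in>product_sums. \<forall>x. (h has_real_derivative h' x) (at x)"
  proof induction
    case (base f g)
    show ?case
      using base by (intro bexI[of _ "\<lambda>x. deriv f x * g x + f x * deriv g x"] allI product_sums.intros smooth_deriv)
        (auto intro!: derivative_eq_intros smooth_deriv(2))
  next
    case (add f g)
    then obtain f' g' where "f' \<in> product_sums" "g' \<in> product_sums"
      "\<forall>x. (f has_real_derivative f' x) (at x)" "\<forall>x. (g has_real_derivative g' x) (at x)" by blast
    then show ?case
      by (intro bexI[of _ "\<lambda>x. f' x + g' x"] allI product_sums.add derivative_intros) auto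
  qed
qed (intro product_sums.base assms)

section \<open>Smooth cut-off functions with compact support\<close>

definition flat_exp :: "real \<Rightarrow> real" where
  "flat_exp x = (if x > 0 then exp (- (1 / x)) else 0)"

lemma poly_mult_exp_neg_tendsto_0:
  fixes p :: "real poly"
  shows "((\<lambda>t. poly p t * exp (- t)) \<longlongrightarrow> 0) at_top"
proof -
  have "((\<lambda>t. \<Sum>i\<le>degree p. coeff p i * (t ^ i / exp t)) \<longlongrightarrow> (\<Sum>i\<le>degree p. coeff p i * 0)) at_top"
    by (intro tendsto_intros tendsto_power_div_exp_0)
  then show ?thesis
    by (simp add: poly_altdef sum_distrib_right exp_minus divide_inverse mult.assoc)
qed

lemma smooth_flat_exp: "smooth flat_exp"
proof -
  define e where "e p x = (if x > 0 then poly p (1 / x) * exp (- (1 / x)) else 0)" for p and x :: real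
  \<comment> \<open>In the variable \<open>t = 1 / x\<close> the function is
    \<open>p(t) exp (- t)\<close>, and differentiation in \<open>x\<close> sends \<open>p\<close> to
    \<open>t\<^sup>2 (p - p')\<close>; the polynomial \<open>[:0, 0, 1:]\<close> is
    \<open>t\<^sup>2\<close>.\<close>
  have "(e p has_real_derivative e ([:0, 0, 1:] * (p - pderiv p)) x) (at x)" for p x
  proof -
    consider "x > 0" | "x < 0" | "x = 0" by linarith
    then show ?thesis
    proof cases
      case 1
      have "((\<lambda>x. poly p (1 / x) * exp (- (1 / x))) has_real_derivative
         e ([:0, 0, 1:] * (p - pderiv p)) x) (at x)"
        using 1
        by (auto intro!: derivative_eq_intros DERIV_chain2[OF poly_DERIV] simp: e_def)
           (simp add: field_simps power2_eq_square)
      then show ?thesis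
        by (rule has_field_derivative_transform_within_open[of _ _ _ "{0<..}"]) (use 1 in \<open>auto simp: e_def\<close>)
    next
      case 2
      have "((\<lambda>x. 0) has_real_derivative e ([:0, 0, 1:] * (p - pderiv p)) x) (at x)"
        using 2 by (auto simp: e_def)
      then show ?thesis
        by (rule has_field_derivative_transform_within_open[of _ _ _ "{..<0}"]) (use 2 in \<open>auto simp: e_def\<close>)
    next
      case 3
      \<comment> \<open>For \<open>h > 0\<close> the difference quotient at \<open>0\<close> is
        \<open>t p(t) exp (- t)\<close> with \<open>t = 1 / h\<close>, which explains the factor
        \<open>[:0, 1:]\<close>.\<close>
      have "((\<lambda>h. poly ([:0, 1:] * p) (inverse h) * exp (- inverse h)) \<longlongrightarrow> 0) (at_right 0)"
        using filterlim_compose[OF poly_mult_exp_neg_tendsto_0 filterlim_inverse_at_top_right] .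
      then have "((\<lambda>h. e p h / h) \<longlongrightarrow> 0) (at_right 0)"
        by (rule Lim_transform_eventually)
           (auto simp: eventually_at_right_field e_def field_simps intro!: exI[of _ 1])
      moreover have "((\<lambda>h. e p h / h) \<longlongrightarrow> 0) (at_left 0)"
        by (rule Lim_transform_eventually[OF tendsto_const])
           (auto simp: eventually_at_left_field e_def intro!: exI[of _ "-1"])
      ultimately have "((\<lambda>h. e p h / h) \<longlongrightarrow> 0) (at 0)"
        by (simp add: filterlim_split_at)
      then show ?thesis unfolding 3 DERIV_def by (simp add: e_def)
    qed
  qed
  then have "smooth (e 1)"
    by (intro smooth_coinduct[of _ "range e"]) auto
  moreover have "e 1 = flat_exp" by (auto simp: e_def flat_exp_def)
  ultimately show ?thesis by simp
qed

text \<open>The shift by \<open>1\<close> keeps the support inside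
  \<open>{p + 1 / k..q - 1 / k}\<close>, strictly within the interval, while scaling by
  \<open>k\<close> drives interior values to \<open>1\<close> without normalisation.\<close>

definition bump :: "real \<Rightarrow> real \<Rightarrow> real \<Rightarrow> real \<Rightarrow> real" where
  "bump p q k x = flat_exp (k * (x - p) - 1) * flat_exp (k * (q - x) - 1)"

lemma smooth_bump: "smooth (bump p q k)"
proof -
  have "smooth (\<lambda>x. (1 * flat_exp (k * x + (- k * p - 1))) * (1 * flat_exp (- k * x + (k * q - 1))))"
    by (intro smooth_mult smooth_affine smooth_flat_exp)
  then show ?thesis by (simp add: bump_def[abs_def] algebra_simps)
qed

lemma bump_bounds: "0 \<le> bump p q k x" "bump p q k x \<le> 1"
  by (auto simp: bump_def flat_exp_def intro!: mult_le_one)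

lemma bump_eq_0: "k > 0 \<Longrightarrow> x \<notin> {p + 1 / k<..<q - 1 / k} \<Longrightarrow> bump p q k x = 0"
  by (auto simp: bump_def flat_exp_def field_simps not_less)

text \<open>Each factor tends to the indicator of a half line, since \<open>flat_exp\<close> is
  \<open>0\<close> on negative arguments and tends to \<open>1\<close> at infinity. At
  \<open>p\<close> and \<open>q\<close> the limit would be \<open>0\<close> while the indicator of a
  nonempty closed interval is \<open>1\<close>.\<close>

lemma bump_tendsto:
  assumes "x \<noteq> p" "x \<noteq> q"
  shows "(\<lambda>k. bump p q (real k) x) \<longlonglongrightarrow> indicator {p..q} x"
proof -
  have E: "(flat_exp \<longlongrightarrow> 1) at_top"
  proof (rule Lim_transform_eventually)
    have "((\<lambda>x::real. - (1 / x)) \<longlongrightarrow> 0) at_top" 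
      using tendsto_minus[OF tendsto_inverse_0_at_top[OF filterlim_ident]] by (simp add: divide_inverse)
    from tendsto_exp[OF this] show "((\<lambda>x::real. exp (- (1 / x))) \<longlongrightarrow> 1) at_top" by simp
    show "\<forall>\<^sub>F x in at_top. exp (- (1 / x)) = flat_exp x"
      using eventually_gt_at_top[of 0] by eventually_elim (simp add: flat_exp_def)
  qed
  have L: "(\<lambda>k. flat_exp (real k * c - 1)) \<longlonglongrightarrow> (if c > 0 then 1 else 0)" if "c \<noteq> 0" for c
  proof (cases "c > 0")
    case True
    have "filterlim (\<lambda>k. real k * c - 1) at_top sequentially"
      using True unfolding diff_conv_add_uminus add.commute[of _ "-1"]
      by (intro filterlim_tendsto_add_at_top[OF tendsto_const]
          filterlim_at_top_mult_tendsto_pos[OF tendsto_const] filterlim_real_sequentially)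
         (auto simp: mult.commute)
    then show ?thesis using True filterlim_compose[OF E] by simp
  next
    case False
    then have "real k * c - 1 \<le> 0" for k by (smt (verit) mult_nonneg_nonpos of_nat_0_le_iff)
    then have "flat_exp (real k * c - 1) = 0" for k by (simp add: flat_exp_def not_less)
    then show ?thesis using False by simp
  qed
  have "(\<lambda>k. bump p q (real k) x) \<longlonglongrightarrow> (if x - p > 0 then 1 else 0) * (if q - x > 0 then 1 else 0)"
    unfolding bump_def using assms by (intro tendsto_mult L) auto
  moreover have "(if x - p > 0 then 1 else 0) * (if q - x > 0 then 1 else 0) = (indicator {p..q} x :: real)"
    using assms by (auto simp: indicator_def)
  ultimately show ?thesis by simp
qed

lemma test_functionsI:
  assumes "smooth \<phi>" "\<And>x. x \<notin> {p..q} \<Longrightarrow> \<phi> x = 0" "0 < p" "q < L"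
  shows "\<phi> \<in> test_functions L"
proof -
  have "closure {x. \<phi> x \<noteq> 0} \<subseteq> {p..q}"
  proof (rule closure_minimal)
    show "{x. \<phi> x \<noteq> 0} \<subseteq> {p..q}" using assms(2) by blast
  qed simp
  moreover from this have "compact (closure {x. \<phi> x \<noteq> 0})"
    by (meson bounded_closed_interval bounded_subset closed_closure compact_eq_bounded_closed)
  ultimately show ?thesis
    using assms(1,3,4) unfolding test_functions_def smooth_def by fastforce
qed

lemma test_functionsE:
  assumes "\<phi> \<in> test_functions L" "0 < L"
  obtains p q where "0 < p" "p < q" "q < L" "\<And>x. x \<notin> {p<..<q} \<Longrightarrow> \<phi> x = 0" "smooth \<phi>"
proof -
  \<comment> \<open>The midpoint is added so that \<open>K\<close> is nonempty even for the zero
    function.\<close>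
  define K where "K = closure {x. \<phi> x \<noteq> 0} \<union> {L / 2}"
  have K: "compact K" "K \<noteq> {}" "K \<subseteq> {0<..<L}"
    using assms unfolding test_functions_def K_def by (auto intro!: compact_Un)
  obtain a b where ab: "a \<in> K" "b \<in> K" "\<And>x. x \<in> K \<Longrightarrow> a \<le> x \<and> x \<le> b"
    using compact_attains_inf[OF K(1,2)] compact_attains_sup[OF K(1,2)] by blast
  show ?thesis
  proof (rule that[of "a / 2" "(b + L) / 2"])
    show "0 < a / 2" "(b + L) / 2 < L" "a / 2 < (b + L) / 2" using ab K by fastforce+
    show "smooth \<phi>" using assms unfolding test_functions_def smooth_def by blast
    fix x assume x: "x \<notin> {a / 2<..<(b + L) / 2}"
    show "\<phi> x = 0"
    proof (rule ccontr)
      assume "\<phi> x \<noteq> 0"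
      then have "x \<in> K" unfolding K_def using closure_subset[of "{x. \<phi> x \<noteq> 0}"] by auto
      then have "a \<le> x" "x \<le> b" "a \<in> {0<..<L}" "b \<in> {0<..<L}" using ab K(3) by auto
      then show False using x by auto
    qed
  qed
qed

lemma bump_test_function:
  assumes "0 \<le> p" "q \<le> L" "k > 0"
  shows "bump p q k \<in> test_functions L"
proof (rule test_functionsI[OF smooth_bump])
  have "1 / k > 0" using assms by simp
  then show "0 < p + 1 / k" "q - 1 / k < L" using assms by linarith+
  show "bump p q k x = 0" if "x \<notin> {p + 1 / k..q - 1 / k}" for x
    using that by (intro bump_eq_0 assms) auto
qed

section \<open>The fundamental lemma of the calculus of variations and the du Bois-Reymond
  lemma\<close>

lemma AE_zero_if_integral_Icc_zero:
  fixes f :: "real \<Rightarrow> real"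
  assumes f: "integrable lborel f" and z: "\<And>a b. a \<le> b \<Longrightarrow> (LINT x:{a..b}|lborel. f x) = 0"
  shows "AE x in lborel. f x = 0"
proof -
  have si: "set_integrable lborel A f" if "A \<in> sets borel" for A
    using that f unfolding set_integrable_def by (intro integrable_mult_indicator) auto
  \<comment> \<open>The complement case of the induction over Borel sets needs the integral over the
    whole line, obtained by exhaustion.\<close>
  have "(\<lambda>n. LINT x:{- real n..real n}|lborel. f x) \<longlonglongrightarrow> (LINT x:(\<Union>n. {- real n..real n})|lborel. f x)"
    by (intro set_integral_cont_up si) (auto simp: incseq_def)
  moreover have "(LINT x:{- real n..real n}|lborel. f x) = 0" for n by (rule z) simp
  moreover have "(\<Union>n. {- real n..real n}) = UNIV"
  proof (intro set_eqI iffI UNIV_I)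
    fix x :: real
    obtain n :: nat where "\<bar>x\<bar> \<le> real n" using real_arch_simple by blast
    then show "x \<in> (\<Union>n. {- real n..real n})" by (intro UN_I[of n]) auto
  qed
  ultimately have U: "(LINT x:UNIV|lborel. f x) = 0" by (simp add: LIMSEQ_const_iff)
  have "(LINT x:A|lborel. f x) = 0" if "A \<in> sets borel" for A
    using that
  proof (induction rule: borel_set_induct)
    case (compl A)
    have "(LINT x:A \<union> - A|lborel. f x) = (LINT x:A|lborel. f x) + (LINT x:-A|lborel. f x)"
      using compl by (intro set_integral_Un si) auto
    then show ?case using U compl by simp
  next
    case (union A)
    have "(LINT x:(\<Union>i. A i)|lborel. f x) = (\<Sum>i. LINT x:A i|lborel. f x)"
      using union by (intro lebesgue_integral_countable_add si) (auto simp: disjoint_family_on_def)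
    then show ?case using union by simp
  next
    case (interval a b)
    then show ?case by (rule z)
  qed (simp add: set_lebesgue_integral_def)
  then show ?thesis
    using density_unique_real[OF f, of "\<lambda>x. 0"] by (simp add: set_lebesgue_integral_def)
qed

lemma integrable_Ioo_iff:
  fixes f :: "real \<Rightarrow> real"
  shows "integrable (lebesgue_on {a<..<b}) f \<longleftrightarrow> f absolutely_integrable_on {a..b}"
proof -
  have "integrable (lebesgue_on {a<..<b}) f \<longleftrightarrow> f absolutely_integrable_on {a<..<b}"
    by (simp add: set_integrable_def integrable_restrict_space)
  then show ?thesis by (simp only: absolutely_integrable_on_Icc_iff_Ioo)
qed

lemma lebesgue_integral_Ioo:
  fixes f :: "real \<Rightarrow> real"
  assumes "f absolutely_integrable_on {a..b}"
  shows "(LINT x|lebesgue_on {a<..<b}. f x) = integral {a..b} f"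
  using assms lebesgue_integral_eq_integral[of "{a<..<b}" f]
  by (simp add: integrable_Ioo_iff integral_open_interval_real)

lemma AE_Ioo_ex:
  fixes a b :: real
  assumes "a < b" "AE x in lebesgue_on {a<..<b}. P x"
  shows "\<exists>x\<in>{a<..<b}. P x"
proof (rule ccontr)
  assume "\<not> ?thesis"
  moreover have "AE x in lebesgue. x \<in> {a<..<b} \<longrightarrow> P x"
    using assms(2) by (subst (asm) AE_restrict_space_iff) (auto intro: sets_completionI_sets)
  ultimately have "AE x in lebesgue. x \<notin> {a<..<b}"
    by (auto elim!: eventually_mono)
  then have "{a<..<b} \<in> null_sets lebesgue" by (subst AE_iff_null_sets) (auto intro: sets_completionI_sets)
  then show False using assms(1) by (auto simp: null_sets_def)
qed

text \<open>Bumps tend to indicators of intervals and are bounded by \<open>1\<close>, so dominated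
  convergence shows that \<open>f\<close> has zero integral over every interval.\<close>

lemma variational_zero:
  fixes f :: "real \<Rightarrow> real"
  assumes f: "f absolutely_integrable_on {0..L}"
    and z: "\<And>\<phi>. \<phi> \<in> test_functions L \<Longrightarrow> integral {0..L} (\<lambda>x. f x * \<phi> x) = 0"
  shows "AE x in lebesgue_on {0<..<L}. f x = 0"
proof -
  define F where "F x = indicator {0<..<L} x * f x" for x
  have F: "integrable lebesgue F"
    using absolutely_integrable_on_Icc_iff_Ioo[THEN iffD1, OF f] by (simp add: F_def[abs_def] set_integrable_def)
  then have Fm [measurable]: "F \<in> borel_measurable lebesgue" by (rule borel_measurable_integrable)
  \<comment> \<open>The induction over Borel sets takes place on \<open>lborel\<close>, whereas
    \<open>F\<close> is only Lebesgue measurable.\<close>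
  obtain F' where F'm: "F' \<in> borel_measurable lborel" and FF': "AE x in lborel. F x = F' x"
    using completion_ex_borel_measurable_real[OF Fm] by blast
  have ae: "AE x in lebesgue. F x = F' x" using AE_completion[OF FF'] .
  have F'l: "F' \<in> borel_measurable lebesgue" using F'm by (rule measurable_completion)
  have F': "integrable lborel F'"
    using integrable_cong_AE[OF Fm F'l ae] F integrable_completion[OF F'm] by simp
  have "(LINT x:{a..b}|lborel. F' x) = 0" if "a \<le> b" for a b
  proof -
    \<comment> \<open>Clipping keeps the bumps inside \<open>(0, L)\<close> and changes nothing,
      because \<open>F\<close> vanishes outside. The case \<open>p > q\<close> is harmless: bump
      limit and indicator are then both \<open>0\<close>.\<close>
    define p q where "p = max a 0" and "q = min b L"
    define B where "B k = bump p q (real (Suc k))" for k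
    have Bm: "B k \<in> borel_measurable lebesgue" for k
      using continuous_imp_measurable_on_sets_lebesgue[OF smooth_continuous_on[OF smooth_bump], of UNIV]
      by (simp add: B_def lebesgue_on_UNIV_eq)
    have Bz: "(LINT x|lebesgue. F x * B k x) = 0" for k
    proof -
      have Bt: "B k \<in> test_functions L"
        unfolding B_def by (rule bump_test_function) (auto simp: p_def q_def)
      have "(\<lambda>x. B k x * f x) absolutely_integrable_on {0..L}"
        using f unfolding B_def
        by (intro absolutely_integrable_continuous_mult smooth_continuous_on smooth_bump)
      then have i: "(\<lambda>x. f x * B k x) absolutely_integrable_on {0..L}" by (simp add: mult.commute)
      have "(LINT x|lebesgue. F x * B k x) = (LINT x|lebesgue_on {0<..<L}. f x * B k x)"
        by (simp add: integral_restrict_space F_def mult.assoc)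
      also have "\<dots> = 0" using lebesgue_integral_Ioo[OF i] z[OF Bt] by simp
      finally show ?thesis .
    qed
    have "(\<lambda>k. LINT x|lebesgue. F x * B k x) \<longlonglongrightarrow> (LINT x|lebesgue. F x * indicator {p..q} x)"
    proof (rule integral_dominated_convergence[where w = "\<lambda>x. \<bar>F x\<bar>"])
      have "AE x in lebesgue. x \<notin> {p, q}"
        by (intro AE_not_in) (simp flip: negligible_iff_null_sets)
      then show "AE x in lebesgue. (\<lambda>k. F x * B k x) \<longlonglongrightarrow> F x * indicator {p..q} x"
      proof eventually_elim
        case (elim x)
        have "(\<lambda>k. B k x) \<longlonglongrightarrow> indicator {p..q} x"
          unfolding B_def using elim LIMSEQ_Suc[OF bump_tendsto[of x p q]] by simp
        then show ?case by (intro tendsto_mult tendsto_const)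
      qed
      show "AE x in lebesgue. norm (F x * B k x) \<le> \<bar>F x\<bar>" for k
        using bump_bounds[of p q "real (Suc k)"] by (auto simp: B_def abs_mult intro!: AE_I2 mult_left_le)
    qed (use F Bm in \<open>auto intro!: borel_measurable_times borel_measurable_indicator\<close>)
    then have "(LINT x|lebesgue. F x * indicator {p..q} x) = 0" using Bz by (simp add: LIMSEQ_const_iff)
    moreover have "(LINT x|lebesgue. F x * indicator {p..q} x) = (LINT x|lebesgue. indicator {a..b} x * F' x)"
    proof (rule integral_cong_AE)
      show "AE x in lebesgue. F x * indicator {p..q} x = indicator {a..b} x * F' x"
        using ae
      proof eventually_elim
        case (elim x)
        then show ?case by (cases "x \<in> {0<..<L}") (auto simp: F_def p_def q_def indicator_def)
      qed
    qed (use F'l in \<open>auto intro!: borel_measurable_times borel_measurable_indicator\<close>)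
    moreover have "(LINT x|lebesgue. indicator {a..b} x * F' x) = (LINT x|lborel. indicator {a..b} x * F' x)"
      using F'm by (intro integral_completion borel_measurable_times) auto
    ultimately show ?thesis by (simp add: set_lebesgue_integral_def)
  qed
  then have "AE x in lborel. F' x = 0" using AE_zero_if_integral_Icc_zero[OF F'] by blast
  with FF' have "AE x in lborel. F x = 0" by eventually_elim simp
  then have "AE x in lebesgue. F x = 0" by (rule AE_completion)
  then have "AE x in lebesgue. x \<in> {0<..<L} \<longrightarrow> f x = 0" by eventually_elim (auto simp: F_def)
  then show ?thesis by (subst AE_restrict_space_iff) auto
qed

text \<open>The primitive vanishes to the left of the support, and zero mean makes it vanish again
  to the right.\<close>

lemma test_function_antiderivative:
  assumes "smooth g" "0 < p" "p < q" "q < L" and g: "\<And>x. x \<notin> {p<..<q} \<Longrightarrow> g x = 0"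
    and z: "integral {0..L} g = 0"
  shows "\<exists>\<phi>\<in>test_functions L. deriv \<phi> = g"
proof -
  define \<phi> where "\<phi> x = integral {0..x} g" for x
  have i: "g integrable_on {a..b}" for a b
    using integrable_continuous_real smooth_continuous_on[OF assms(1)] by blast
  have lo: "\<phi> x = 0" if "x \<le> p" for x
  proof -
    have "integral {0..x} g = integral {0..x} (\<lambda>x. 0)"
      using that g by (intro Henstock_Kurzweil_Integration.integral_cong) auto
    then show ?thesis by (simp add: \<phi>_def)
  qed
  have hi: "\<phi> x = 0" if "q \<le> x" for x
  proof -
    have 0: "integral {q..y} g = 0" for y
    proof -
      have "integral {q..y} g = integral {q..y} (\<lambda>x. 0)"
        using g by (intro Henstock_Kurzweil_Integration.integral_cong) auto
      then show ?thesis by simp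
    qed
    have "integral {0..q} g + integral {q..L} g = integral {0..L} g"
      using assms by (intro Henstock_Kurzweil_Integration.integral_combine i) auto
    moreover have "integral {0..q} g + integral {q..x} g = integral {0..x} g"
      using assms that by (intro Henstock_Kurzweil_Integration.integral_combine i) auto
    ultimately show ?thesis using z 0 by (simp add: \<phi>_def)
  qed
  have D: "(\<phi> has_real_derivative g x) (at x)" for x
  proof (cases "x < p")
    case True
    have "((\<lambda>x. 0) has_real_derivative g x) (at x)" using True g[of x] by simp
    then show ?thesis
      by (rule has_field_derivative_transform_within_open[of _ _ _ "{..<p}"]) (use True lo in auto)
  next
    case False
    have "(\<phi> has_real_derivative g x) (at x within {0..x + 1})"
      unfolding \<phi>_def using False assms(2)
      by (intro integral_has_real_derivative smooth_continuous_on assms) auto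
    moreover have "at x within {0..x + 1} = at x"
      using False assms(2) by (intro at_within_interior) auto
    ultimately show ?thesis by simp
  qed
  have "\<phi> \<in> test_functions L"
    using lo hi assms(2,4) by (intro test_functionsI[of _ p q] smooth_antiderivative[OF assms(1)] D) (auto simp: not_le intro: less_imp_le)
  moreover have "deriv \<phi> = g" using D DERIV_imp_deriv by blast
  ultimately show ?thesis by blast
qed

lemma test_function_continuous:
  assumes "\<phi> \<in> test_functions L" "0 < L"
  shows "continuous_on A \<phi>" "continuous_on A (deriv \<phi>)"
  using test_functionsE[OF assms] smooth_continuous_on smooth_deriv(1) by metis+

lemma absolutely_integrable_mult_continuous:
  fixes f g :: "real \<Rightarrow> real"
  assumes "g absolutely_integrable_on {a..b}" "continuous_on {a..b} f"
  shows "(\<lambda>x. g x * f x) absolutely_integrable_on {a..b}"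
  using absolutely_integrable_continuous_mult[OF assms(2,1)] by (simp add: mult.commute)

text \<open>Subtracting from a test function \<open>\<eta>\<close> a multiple of a fixed
  \<open>e\<close> with nonzero integral leaves mean zero, hence the derivative of a test function.
  The orthogonality then says that \<open>f - c\<close> annihilates every \<open>\<eta>\<close>,
  where \<open>c\<close> is the mean of \<open>f\<close> weighted by \<open>e\<close>.\<close>

lemma du_Bois_Reymond:
  fixes f :: "real \<Rightarrow> real"
  assumes L: "0 < L" and f: "f absolutely_integrable_on {0..L}"
    and z: "\<And>\<phi>. \<phi> \<in> test_functions L \<Longrightarrow> integral {0..L} (\<lambda>x. f x * deriv \<phi> x) = 0"
  shows "\<exists>c. AE x in lebesgue_on {0<..<L}. f x = c"
proof -
  have one: "(\<lambda>x. 1::real) absolutely_integrable_on {0..L}"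
    by (intro absolutely_integrable_continuous_real continuous_on_const)
  have "\<exists>\<eta>\<in>test_functions L. integral {0..L} \<eta> \<noteq> 0"
  proof (rule ccontr)
    assume "\<not> ?thesis"
    then have "AE x in lebesgue_on {0<..<L}. (1::real) = 0"
      by (intro variational_zero[OF one]) simp
    from AE_Ioo_ex[OF L this] show False by simp
  qed
  then obtain e where e: "e \<in> test_functions L" "integral {0..L} e \<noteq> 0" by blast
  define m where "m = integral {0..L} e"
  define c where "c = integral {0..L} (\<lambda>x. f x * e x) / m"
  have fi: "(\<lambda>x. f x * h x) integrable_on {0..L}" if "continuous_on {0..L} h" for h
    using absolutely_integrable_mult_continuous[OF f that] set_lebesgue_integral_eq_integral(1) by blast
  have "AE x in lebesgue_on {0<..<L}. f x - c = 0"
  proof (rule variational_zero)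
    show "(\<lambda>x. f x - c) absolutely_integrable_on {0..L}"
      by (intro set_integral_diff(1) f absolutely_integrable_continuous_real continuous_on_const)
    fix \<eta> assume \<eta>: "\<eta> \<in> test_functions L"
    define r where "r = integral {0..L} \<eta> / m"
    obtain p q where pq: "0 < p" "p < q" "q < L" "\<And>x. x \<notin> {p<..<q} \<Longrightarrow> \<eta> x = 0" "smooth \<eta>"
      using test_functionsE[OF \<eta> L] by metis
    obtain p' q' where pq': "0 < p'" "p' < q'" "q' < L" "\<And>x. x \<notin> {p'<..<q'} \<Longrightarrow> e x = 0" "smooth e"
      using test_functionsE[OF e(1) L] by metis
    note co = smooth_continuous_on[OF pq(5), of "{0..L}"] smooth_continuous_on[OF pq'(5), of "{0..L}"]
    have "smooth (\<lambda>x. \<eta> x - r * e (1 * x + 0))"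
      by (intro smooth_diff smooth_affine pq pq')
    then have s: "smooth (\<lambda>x. \<eta> x - r * e x)" by simp
    have "integral {0..L} (\<lambda>x. \<eta> x - r * e x) = integral {0..L} \<eta> - r * m"
      using co by (subst Henstock_Kurzweil_Integration.integral_diff)
        (auto simp: m_def intro!: integrable_continuous_real continuous_intros)
    then have "integral {0..L} (\<lambda>x. \<eta> x - r * e x) = 0" using e(2) by (simp add: r_def m_def)
    moreover have "\<eta> x - r * e x = 0" if "x \<notin> {min p p'<..<max q q'}" for x
    proof -
      have "x \<notin> {p<..<q}" "x \<notin> {p'<..<q'}" using that by auto
      then show ?thesis using pq(4) pq'(4) by simp
    qed
    ultimately obtain \<phi> where \<phi>: "\<phi> \<in> test_functions L" "deriv \<phi> = (\<lambda>x. \<eta> x - r * e x)"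
      using test_function_antiderivative[OF s, of "min p p'" "max q q'" L] pq(1-3) pq'(1-3) by fastforce
    have "0 = integral {0..L} (\<lambda>x. f x * (\<eta> x - r * e x))" using z[OF \<phi>(1)] \<phi>(2) by simp
    also have "\<dots> = integral {0..L} (\<lambda>x. f x * \<eta> x - r * (f x * e x))" by (simp add: algebra_simps)
    also have "\<dots> = integral {0..L} (\<lambda>x. f x * \<eta> x) - r * integral {0..L} (\<lambda>x. f x * e x)"
      using fi co by (subst Henstock_Kurzweil_Integration.integral_diff) (auto intro!: integrable_on_mult_right)
    also have "r * integral {0..L} (\<lambda>x. f x * e x) = c * integral {0..L} \<eta>"
      by (simp add: r_def c_def)
    also have "integral {0..L} (\<lambda>x. f x * \<eta> x) - c * integral {0..L} \<eta> = integral {0..L} (\<lambda>x. f x * \<eta> x - c * \<eta> x)"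
      using fi co by (subst Henstock_Kurzweil_Integration.integral_diff) (auto intro!: integrable_on_mult_right integrable_continuous_real continuous_on_mult_left)
    also have "\<dots> = integral {0..L} (\<lambda>x. (f x - c) * \<eta> x)" by (simp add: algebra_simps)
    finally show "integral {0..L} (\<lambda>x. (f x - c) * \<eta> x) = 0" by simp
  qed
  then show ?thesis by auto
qed

section \<open>Square integrable functions and weak derivatives as primitives\<close>

lemma L2_space_integrable:
  assumes "f \<in> L2_space L"
  shows "f absolutely_integrable_on {0..L}"
proof -
  have "integrable (lebesgue_on {0<..<L}) (\<lambda>x. 1 + (f x)\<^sup>2)"
    using assms integrable_Ioo_iff[THEN iffD2, OF absolutely_integrable_continuous_real[OF continuous_on_const]]
    unfolding L2_space_def by (intro Bochner_Integration.integrable_add) auto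
  then have "integrable (lebesgue_on {0<..<L}) f"
  proof (rule Bochner_Integration.integrable_bound)
    show "f \<in> borel_measurable (lebesgue_on {0<..<L})" using assms by (simp add: L2_space_def)
    have "\<bar>y\<bar> \<le> \<bar>1 + y\<^sup>2\<bar>" for y :: real
      using zero_le_power2[of "\<bar>y\<bar> - 1"] by (simp add: power2_diff)
    then show "AE x in lebesgue_on {0<..<L}. norm (f x) \<le> norm (1 + (f x)\<^sup>2)" by simp
  qed
  then show ?thesis by (simp add: integrable_Ioo_iff)
qed

lemma continuous_imp_L2_space:
  assumes "continuous_on {0..L} f"
  shows "f \<in> L2_space L"
proof -
  have "f absolutely_integrable_on {0..L}" "(\<lambda>x. (f x)\<^sup>2) absolutely_integrable_on {0..L}"
    using assms by (auto intro!: absolutely_integrable_continuous_real continuous_intros)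
  then show ?thesis
    unfolding L2_space_def integrable_Ioo_iff[symmetric] by (auto dest: borel_measurable_integrable)
qed

lemma L2_space_add:
  assumes "f \<in> L2_space L" "g \<in> L2_space L"
  shows "(\<lambda>x. f x + g x) \<in> L2_space L"
proof -
  have m: "f \<in> borel_measurable (lebesgue_on {0<..<L})" "g \<in> borel_measurable (lebesgue_on {0<..<L})"
    using assms by (auto simp: L2_space_def)
  have "integrable (lebesgue_on {0<..<L}) (\<lambda>x. 2 * (f x)\<^sup>2 + 2 * (g x)\<^sup>2)"
    using assms by (auto simp: L2_space_def)
  then have "integrable (lebesgue_on {0<..<L}) (\<lambda>x. (f x + g x)\<^sup>2)"
  proof (rule Bochner_Integration.integrable_bound)
    have "(y + z)\<^sup>2 \<le> 2 * y\<^sup>2 + 2 * z\<^sup>2" for y z :: real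
      using zero_le_power2[of "y - z"] by (simp add: power2_diff power2_sum)
    then show "AE x in lebesgue_on {0<..<L}. norm ((f x + g x)\<^sup>2) \<le> norm (2 * (f x)\<^sup>2 + 2 * (g x)\<^sup>2)"
      by (auto intro!: AE_I2)
  qed (use m in measurable)
  then show ?thesis using m by (simp add: L2_space_def)
qed

text \<open>Passes from Bochner integrals over the open interval to Henstock-Kurzweil integrals over
  the closed one, where integration by parts is available.\<close>

lemma has_weak_deriv_iff:
  assumes L: "0 < L" and u: "u absolutely_integrable_on {0..L}" and v: "v absolutely_integrable_on {0..L}"
  shows "has_weak_deriv L u v \<longleftrightarrow>
    (\<forall>\<phi>\<in>test_functions L. integral {0..L} (\<lambda>x. u x * deriv \<phi> x) = - integral {0..L} (\<lambda>x. v x * \<phi> x))"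
proof -
  have "(LINT x|lebesgue_on {0<..<L}. u x * deriv \<phi> x) = integral {0..L} (\<lambda>x. u x * deriv \<phi> x)"
    "(LINT x|lebesgue_on {0<..<L}. v x * \<phi> x) = integral {0..L} (\<lambda>x. v x * \<phi> x)"
    if "\<phi> \<in> test_functions L" for \<phi>
    using u v test_function_continuous[OF that L]
    by (auto intro!: lebesgue_integral_Ioo absolutely_integrable_mult_continuous)
  then show ?thesis unfolding has_weak_deriv_def by simp
qed

lemma primitive_on_test_function:
  assumes L: "0 < L" and F: "primitive_on 0 L F f" and \<phi>: "\<phi> \<in> test_functions L"
  shows "integral {0..L} (\<lambda>x. F x * deriv \<phi> x) = - integral {0..L} (\<lambda>x. f x * \<phi> x)"
proof -
  obtain p q where pq: "0 < p" "p < q" "q < L" "\<And>x. x \<notin> {p<..<q} \<Longrightarrow> \<phi> x = 0" "smooth \<phi>"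
    using test_functionsE[OF \<phi> L] by metis
  have "primitive_on 0 L \<phi> (deriv \<phi>)"
    using pq(5) smooth_deriv by (intro primitive_on_derivative smooth_continuous_on) auto
  from primitive_onD(2)[OF primitive_on_mult[OF F this], of 0 L]
  have "((\<lambda>x. f x * \<phi> x + F x * deriv \<phi> x) has_integral 0) {0..L}"
    using L pq(1-3) pq(4)[of 0] pq(4)[of L] by simp
  then have "integral {0..L} (\<lambda>x. f x * \<phi> x + F x * deriv \<phi> x) = 0" by (rule integral_unique)
  moreover have "integral {0..L} (\<lambda>x. f x * \<phi> x + F x * deriv \<phi> x) =
     integral {0..L} (\<lambda>x. f x * \<phi> x) + integral {0..L} (\<lambda>x. F x * deriv \<phi> x)"
    by (intro Henstock_Kurzweil_Integration.integral_add set_lebesgue_integral_eq_integral(1)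
        absolutely_integrable_mult_continuous[OF primitive_onD(1)[OF F]]
        absolutely_integrable_continuous_real[OF continuous_on_mult] test_function_continuous[OF \<phi> L]
        primitive_on_continuous[OF F])
  ultimately show ?thesis by simp
qed

lemma primitive_on_imp_weak_deriv:
  assumes L: "0 < L" and F: "primitive_on 0 L F f"
  shows "has_weak_deriv L F f"
  using primitive_on_test_function[OF L F] primitive_onD(1)[OF F]
    absolutely_integrable_continuous_real[OF primitive_on_continuous[OF F]]
  by (subst has_weak_deriv_iff[OF L]) auto

text \<open>The difference between \<open>u\<close> and the indefinite integral of \<open>v\<close>
  has weak derivative zero, so it is constant almost everywhere.\<close>

lemma weak_deriv_imp_primitive_on:
  assumes L: "0 < L" and u: "u \<in> L2_space L" and v: "v \<in> L2_space L" and w: "has_weak_deriv L u v"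
  obtains U where "primitive_on 0 L U v" "AE x in lebesgue_on {0<..<L}. u x = U x"
proof -
  note ui = L2_space_integrable[OF u] and vi = L2_space_integrable[OF v]
  have V: "primitive_on 0 L (\<lambda>x. c + integral {0..x} v) v" for c
    by (rule primitive_on_integral[OF vi])
  have Vi: "(\<lambda>x. 0 + integral {0..x} v) absolutely_integrable_on {0..L}"
    using absolutely_integrable_continuous_real[OF primitive_on_continuous[OF V]] .
  have "\<exists>c. AE x in lebesgue_on {0<..<L}. u x - (0 + integral {0..x} v) = c"
  proof (rule du_Bois_Reymond[OF L])
    show "(\<lambda>x. u x - (0 + integral {0..x} v)) absolutely_integrable_on {0..L}"
      using ui Vi by (rule set_integral_diff(1))
    fix \<phi> assume \<phi>: "\<phi> \<in> test_functions L"
    note c = test_function_continuous(2)[OF \<phi> L, of "{0..L}"]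
    have "integral {0..L} (\<lambda>x. (u x - (0 + integral {0..x} v)) * deriv \<phi> x) =
       integral {0..L} (\<lambda>x. u x * deriv \<phi> x - (0 + integral {0..x} v) * deriv \<phi> x)"
      by (simp add: algebra_simps)
    also have "\<dots> = integral {0..L} (\<lambda>x. u x * deriv \<phi> x) - integral {0..L} (\<lambda>x. (0 + integral {0..x} v) * deriv \<phi> x)"
      using ui Vi c by (intro Henstock_Kurzweil_Integration.integral_diff set_lebesgue_integral_eq_integral(1)
        absolutely_integrable_mult_continuous)
    also have "\<dots> = 0"
      using w[unfolded has_weak_deriv_iff[OF L ui vi]] primitive_on_test_function[OF L V \<phi>, of 0] \<phi> by simp
    finally show "integral {0..L} (\<lambda>x. (u x - (0 + integral {0..x} v)) * deriv \<phi> x) = 0" .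
  qed
  then obtain c where "AE x in lebesgue_on {0<..<L}. u x - (0 + integral {0..x} v) = c" by blast
  then have "AE x in lebesgue_on {0<..<L}. u x = c + integral {0..x} v" by eventually_elim simp
  with V show ?thesis by (rule that)
qed

text \<open>The weak formulation quantifies over all representatives of the weak derivative; this
  reduces them to one.\<close>

lemma primitive_on_AE_unique:
  assumes L: "0 < L" and u: "primitive_on 0 L u v" "has_weak_deriv L u w" "w \<in> L2_space L"
  shows "AE x in lebesgue_on {0<..<L}. w x = v x"
proof -
  note wi = L2_space_integrable[OF u(3)] and vi = primitive_onD(1)[OF u(1)]
  note ui = absolutely_integrable_continuous_real[OF primitive_on_continuous[OF u(1)]]
  have "AE x in lebesgue_on {0<..<L}. w x - v x = 0"
  proof (rule variational_zero)
    show "(\<lambda>x. w x - v x) absolutely_integrable_on {0..L}"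
      using wi vi by (rule set_integral_diff(1))
    fix \<phi> assume \<phi>: "\<phi> \<in> test_functions L"
    note c = test_function_continuous(1)[OF \<phi> L, of "{0..L}"]
    have "integral {0..L} (\<lambda>x. (w x - v x) * \<phi> x) = integral {0..L} (\<lambda>x. w x * \<phi> x - v x * \<phi> x)"
      by (simp add: algebra_simps)
    also have "\<dots> = integral {0..L} (\<lambda>x. w x * \<phi> x) - integral {0..L} (\<lambda>x. v x * \<phi> x)"
      using wi vi c by (intro Henstock_Kurzweil_Integration.integral_diff set_lebesgue_integral_eq_integral(1)
        absolutely_integrable_mult_continuous)
    also have "\<dots> = 0"
      using u(2)[unfolded has_weak_deriv_iff[OF L ui wi]] primitive_on_test_function[OF L u(1) \<phi>] \<phi> by simp
    finally show "integral {0..L} (\<lambda>x. (w x - v x) * \<phi> x) = 0" .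
  qed
  then show ?thesis by eventually_elim simp
qed

section \<open>The lower bound\<close>

text \<open>Testing the weak equation against \<open>\<psi> x = \<integral>\<^sub>0\<^sup>x g\<close> with \<open>g = u' + \<integral>\<^sub>0\<^sup>x a u\<close> and integrating by parts
  gives \<open>\<integral> g\<^sup>2 = 0\<close>; the constant test function supplies \<open>\<integral> a u = 0\<close>.\<close>

lemma weak_neumann_solution_regular:
  assumes L: "0 < L" and a: "a \<in> L1_space L" and u: "weak_neumann_solution L a u"
  obtains U V where "primitive_on 0 L U V" "primitive_on 0 L V (\<lambda>x. - (a x * U x))" "V 0 = 0" "V L = 0"
    "AE x in lebesgue_on {0<..<L}. u x = U x"
proof -
  have ai: "a absolutely_integrable_on {0..L}" using a by (simp add: L1_space_def integrable_Ioo_iff)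
  obtain w where w: "w \<in> L2_space L" "has_weak_deriv L u w" and u2: "u \<in> L2_space L"
    using u unfolding weak_neumann_solution_def H1_space_def by blast
  note wi = L2_space_integrable[OF w(1)]
  obtain U where U: "primitive_on 0 L U w" "AE x in lebesgue_on {0<..<L}. u x = U x"
    using weak_deriv_imp_primitive_on[OF L u2 w] .
  have aU: "(\<lambda>x. a x * U x) absolutely_integrable_on {0..L}"
    by (rule absolutely_integrable_mult_continuous[OF ai primitive_on_continuous[OF U(1)]])
  define A where "A x = 0 + integral {0..x} (\<lambda>x. a x * U x)" for x
  have A: "primitive_on 0 L A (\<lambda>x. a x * U x)"
    unfolding A_def by (rule primitive_on_integral[OF aU])
  have um: "u \<in> borel_measurable (lebesgue_on {0<..<L})" "a \<in> borel_measurable (lebesgue_on {0<..<L})"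
    using u2 a by (auto simp: L2_space_def L1_space_def)
  have weak: "(LINT x|lebesgue_on {0<..<L}. w x * g x) = integral {0..L} (\<lambda>x. a x * U x * G x)"
    if g: "g \<in> L2_space L" and G: "primitive_on 0 L G g" for g G
  proof -
    have "G \<in> L2_space L" by (rule continuous_imp_L2_space[OF primitive_on_continuous[OF G]])
    then have "G \<in> H1_space L"
      unfolding H1_space_def using primitive_on_imp_weak_deriv[OF L G] g by blast
    then have "(LINT x|lebesgue_on {0<..<L}. w x * g x) = (LINT x|lebesgue_on {0<..<L}. a x * u x * G x)"
      using u w g primitive_on_imp_weak_deriv[OF L G] unfolding weak_neumann_solution_def by blast
    also have "\<dots> = (LINT x|lebesgue_on {0<..<L}. a x * U x * G x)"
    proof (rule integral_cong_AE)
      have i: "(\<lambda>x. a x * U x * G x) absolutely_integrable_on {0..L}"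
        by (rule absolutely_integrable_mult_continuous[OF aU primitive_on_continuous[OF G]])
      then show "(\<lambda>x. a x * U x * G x) \<in> borel_measurable (lebesgue_on {0<..<L})"
        by (simp flip: integrable_Ioo_iff)
      show "(\<lambda>x. a x * u x * G x) \<in> borel_measurable (lebesgue_on {0<..<L})"
        using um \<open>G \<in> L2_space L\<close> by (auto simp: L2_space_def intro!: borel_measurable_times)
      show "AE x in lebesgue_on {0<..<L}. a x * u x * G x = a x * U x * G x"
        using U(2) by eventually_elim simp
    qed
    also have "\<dots> = integral {0..L} (\<lambda>x. a x * U x * G x)"
      by (intro lebesgue_integral_Ioo absolutely_integrable_mult_continuous[OF aU primitive_on_continuous[OF G]])
    finally show ?thesis .
  qed
  have A0: "A 0 = 0" by (simp add: A_def)
  have AL: "A L = 0"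
  proof -
    \<comment> \<open>Testing with the constant \<open>1\<close> makes the left side of the weak
      equation vanish.\<close>
    have "primitive_on 0 L (\<lambda>x. 1) (\<lambda>x. 0)" by (auto simp: primitive_on_def)
    from weak[OF _ this] show ?thesis by (simp add: A_def L2_space_def)
  qed
  define g where "g x = w x + A x" for x
  have g2: "g \<in> L2_space L"
    unfolding g_def by (intro L2_space_add w continuous_imp_L2_space primitive_on_continuous[OF A])
  have gi: "g absolutely_integrable_on {0..L}" by (rule L2_space_integrable[OF g2])
  define G where "G x = 0 + integral {0..x} g" for x
  have G: "primitive_on 0 L G g" unfolding G_def by (rule primitive_on_integral[OF gi])
  have Ag: "(\<lambda>x. A x * g x) absolutely_integrable_on {0..L}"
    by (rule absolutely_integrable_continuous_mult[OF primitive_on_continuous[OF A] gi])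
  \<comment> \<open>Integration by parts without boundary terms, because \<open>A\<close> vanishes
    at both ends.\<close>
  have AG: "((\<lambda>x. a x * U x * G x + A x * g x) has_integral 0) {0..L}"
    using primitive_onD(2)[OF primitive_on_mult[OF A G], of 0 L] L A0 AL by simp
  have gg: "integrable (lebesgue_on {0<..<L}) (\<lambda>x. (g x)\<^sup>2)" using g2 by (simp add: L2_space_def)
  have Agi: "integrable (lebesgue_on {0<..<L}) (\<lambda>x. A x * g x)" using Ag by (simp add: integrable_Ioo_iff)
  \<comment> \<open>The bracket equals \<open>w g\<close>, to which the weak equation applies with
    test function \<open>G\<close>; writing it as a difference supplies its integrability.\<close>
  have "(LINT x|lebesgue_on {0<..<L}. (g x)\<^sup>2) = (LINT x|lebesgue_on {0<..<L}. ((g x)\<^sup>2 - A x * g x) + A x * g x)"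
    by simp
  also have "\<dots> = (LINT x|lebesgue_on {0<..<L}. (g x)\<^sup>2 - A x * g x) + (LINT x|lebesgue_on {0<..<L}. A x * g x)"
    using gg Agi by (intro Bochner_Integration.integral_add Bochner_Integration.integrable_diff)
  also have "(LINT x|lebesgue_on {0<..<L}. (g x)\<^sup>2 - A x * g x) = (LINT x|lebesgue_on {0<..<L}. w x * g x)"
    by (simp add: g_def power2_eq_square algebra_simps)
  also have "\<dots> = integral {0..L} (\<lambda>x. a x * U x * G x)" by (rule weak[OF g2 G])
  also have "(LINT x|lebesgue_on {0<..<L}. A x * g x) = integral {0..L} (\<lambda>x. A x * g x)"
    by (rule lebesgue_integral_Ioo[OF Ag])
  also have "integral {0..L} (\<lambda>x. a x * U x * G x) + integral {0..L} (\<lambda>x. A x * g x) = 0"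
    using AG Ag absolutely_integrable_mult_continuous[OF aU primitive_on_continuous[OF G]]
    by (subst Henstock_Kurzweil_Integration.integral_add[symmetric])
       (auto dest: set_lebesgue_integral_eq_integral(1) integral_unique)
  finally have "AE x in lebesgue_on {0<..<L}. (g x)\<^sup>2 = 0"
    using gg by (subst (asm) integral_nonneg_eq_0_iff_AE) auto
  then have "AE x in lebesgue_on {0<..<L}. w x = - A x"
    by eventually_elim (simp add: g_def eq_neg_iff_add_eq_0)
  from primitive_on_AE[OF U(1) this] primitive_on_uminus[OF A] show ?thesis
    using A0 AL U(2) by (intro that[of U "\<lambda>x. - A x"]) auto
qed

lemma Lambda_set_lower_bound:
  assumes L: "0 < L" and n: "n \<ge> 1" and a: "a \<in> Lambda_set L n"
  shows "2 * pi * real n * (real n + 1) / L * cot (pi * real n / (2 * (real n + 1)))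
    < L1_norm L (\<lambda>x. a x - neumann_eigenvalue L n)"
proof -
  define \<omega> where "\<omega> = real n * pi / L"
  have w2: "neumann_eigenvalue L n = \<omega>\<^sup>2"
    by (simp add: neumann_eigenvalue_def \<omega>_def power_mult_distrib power_divide)
  obtain u where a1: "a \<in> L1_space L" and prec: "prec_ae L (\<lambda>x. \<omega>\<^sup>2) a"
    and u: "weak_neumann_solution L a u" "nontrivial L u"
    using a unfolding Lambda_set_def w2 by blast
  obtain U V where UV: "primitive_on 0 L U V" "primitive_on 0 L V (\<lambda>x. - (a x * U x))" "V 0 = 0" "V L = 0"
    "AE x in lebesgue_on {0<..<L}. u x = U x"
    using weak_neumann_solution_regular[OF L a1 u(1)] .
  have ai: "a absolutely_integrable_on {0..L}" using a1 by (simp add: L1_space_def integrable_Ioo_iff)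
  \<comment> \<open>Otherwise \<open>U\<close> and \<open>V\<close> both vanish at \<open>0\<close>,
    and uniqueness makes the solution trivial.\<close>
  have U0: "U 0 \<noteq> 0"
  proof
    assume "U 0 = 0"
    then have U: "U x = 0" if "x \<in> {0..L}" for x
      using ode_unique[OF UV(1,2) ai] UV(3) that by blast
    have "AE x in lebesgue_on {0<..<L}. u x = 0"
      using UV(5) AE_space[of "lebesgue_on {0<..<L}"] by eventually_elim (simp add: U)
    then show False using u(2) by (simp add: nontrivial_def)
  qed
  \<comment> \<open>The absolute value makes \<open>q\<close> nonnegative everywhere; it alters
    \<open>a - \<omega>\<^sup>2\<close> only on a null set, which the integral form of the equation
    does not see.\<close>
  define q where "q x = \<bar>a x - \<omega>\<^sup>2\<bar>" for x
  have di: "(\<lambda>x. a x - \<omega>\<^sup>2) absolutely_integrable_on {0..L}"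
    by (intro set_integral_diff(1) ai absolutely_integrable_continuous_real continuous_on_const)
  then have qi: "q absolutely_integrable_on {0..L}" unfolding q_def by (rule set_integrable_abs)
  have "AE x in lebesgue. x \<in> {0..L} \<longrightarrow> \<omega>\<^sup>2 \<le> a x"
    using prec unfolding prec_ae_def by (subst (asm) AE_restrict_space_iff) auto
  then have "AE x in lebesgue. x \<in> {0<..<L} \<longrightarrow> \<omega>\<^sup>2 \<le> a x" by eventually_elim auto
  then have le: "AE x in lebesgue_on {0<..<L}. \<omega>\<^sup>2 \<le> a x"
    by (subst AE_restrict_space_iff) auto
  then have "AE x in lebesgue_on {0<..<L}. - (a x * U x) = - ((\<omega>\<^sup>2 + q x) * U x)"
    by eventually_elim (simp add: q_def)
  then have V': "primitive_on 0 L V (\<lambda>x. - ((\<omega>\<^sup>2 + q x) * U x))"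
    by (rule primitive_on_AE[OF UV(2)])
  have norm: "L1_norm L (\<lambda>x. a x - \<omega>\<^sup>2) = integral {0..L} q"
    unfolding L1_norm_def using lebesgue_integral_Ioo[OF qi] by (simp add: q_def)
  have "integral {0..L} q \<noteq> 0"
  proof
    assume "integral {0..L} q = 0"
    then have "(LINT x|lebesgue_on {0<..<L}. q x) = 0" using lebesgue_integral_Ioo[OF qi] by simp
    moreover have "integrable (lebesgue_on {0<..<L}) q" using qi by (simp add: integrable_Ioo_iff)
    ultimately have "AE x in lebesgue_on {0<..<L}. q x = 0"
      by (subst (asm) integral_nonneg_eq_0_iff_AE) (auto simp: q_def)
    then have "AE x in lebesgue. x \<in> {0<..<L} \<longrightarrow> q x = 0"
      by (subst (asm) AE_restrict_space_iff) auto
    moreover have "AE x in lebesgue. x \<notin> {0, L}"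
      by (intro AE_not_in) (simp flip: negligible_iff_null_sets)
    ultimately have "AE x in lebesgue. x \<notin> {x \<in> {0..L}. \<omega>\<^sup>2 < a x}"
      by eventually_elim (auto simp: q_def)
    note N = this
    have pos: "emeasure lebesgue {x \<in> {0..L}. \<omega>\<^sup>2 < a x} > 0"
      using prec by (simp add: prec_ae_def)
    \<comment> \<open>A nonmeasurable set has \<open>emeasure\<close> zero by convention, so
      positive measure implies measurability.\<close>
    have "{x \<in> {0..L}. \<omega>\<^sup>2 < a x} \<in> sets lebesgue"
    proof (rule ccontr)
      assume "\<not> ?thesis"
      from emeasure_notin_sets[OF this] pos show False by simp
    qed
    then have "{x \<in> {0..L}. \<omega>\<^sup>2 < a x} \<in> null_sets lebesgue"
      using N by (simp only: AE_iff_null_sets)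
    then show False using pos by (auto simp: null_sets_def)
  qed
  moreover have "integral {0..L} q \<ge> 0"
    using qi by (intro Henstock_Kurzweil_Integration.integral_nonneg set_lebesgue_integral_eq_integral(1)) (auto simp: q_def)
  ultimately have "integral {0..L} q > 0" by simp
  then show ?thesis
    unfolding w2 norm
    using neumann_integral_lower_bound[of L n, folded \<omega>_def, OF L n UV(1) V' qi _ _ UV(3,4) U0]
    by (auto simp: q_def)
qed

section \<open>Potentials concentrated near the extrema\<close>

lemma primitive_on_derivative_off_finite:
  assumes X: "finite X" and F: "continuous_on {a..b} F" and f: "f absolutely_integrable_on {a..b}"
    and d: "\<And>x. x \<in> {a<..<b} - X \<Longrightarrow> (F has_real_derivative f x) (at x)"
  shows "primitive_on a b F f"
  unfolding primitive_on_def
proof (intro conjI allI impI f)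
  fix x y assume "a \<le> x" "x \<le> y" "y \<le> b"
  then show "(f has_integral F y - F x) {x..y}"
    using d continuous_on_subset[OF F, of "{x..y}"]
    by (intro fundamental_theorem_of_calculus_interior_strong[OF X])
       (auto simp: has_real_derivative_iff_has_vector_derivative[symmetric])
qed

text \<open>Integrating \<open>V P\<close> by parts, where \<open>P\<close> is the absolutely
  continuous representative of the test function, gives the weak equation;
  \<open>V 0 = V L = 0\<close> removes the boundary terms for arbitrary values of \<open>P\<close>
  at the ends.\<close>

lemma weak_neumann_solutionI:
  assumes L: "0 < L" and a: "a absolutely_integrable_on {0..L}"
    and U: "primitive_on 0 L U V" and V: "primitive_on 0 L V (\<lambda>x. - (a x * U x))" and bd: "V 0 = 0" "V L = 0"
  shows "weak_neumann_solution L a U"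
  unfolding weak_neumann_solution_def
proof (intro conjI ballI impI)
  note cU = primitive_on_continuous[OF U] and cV = primitive_on_continuous[OF V]
  show "U \<in> H1_space L"
    using continuous_imp_L2_space[OF cU] continuous_imp_L2_space[OF cV] primitive_on_imp_weak_deriv[OF L U]
    unfolding H1_space_def by blast
  fix u' \<psi> \<psi>' assume u': "u' \<in> L2_space L" "has_weak_deriv L U u'"
    and \<psi>: "\<psi> \<in> H1_space L" "\<psi>' \<in> L2_space L" "has_weak_deriv L \<psi> \<psi>'"
  have \<psi>2: "\<psi> \<in> L2_space L" using \<psi> by (simp add: H1_space_def)
  obtain P where P: "primitive_on 0 L P \<psi>'" "AE x in lebesgue_on {0<..<L}. \<psi> x = P x"
    using weak_deriv_imp_primitive_on[OF L \<psi>2 \<psi>(2,3)] .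
  have ae: "AE x in lebesgue_on {0<..<L}. u' x = V x" by (rule primitive_on_AE_unique[OF L U u'(2,1)])
  have i1: "(\<lambda>x. V x * \<psi>' x) absolutely_integrable_on {0..L}"
    by (rule absolutely_integrable_continuous_mult[OF cV primitive_onD(1)[OF P(1)]])
  have aU: "(\<lambda>x. a x * U x) absolutely_integrable_on {0..L}"
    by (rule absolutely_integrable_mult_continuous[OF a cU])
  have i2: "(\<lambda>x. a x * U x * P x) absolutely_integrable_on {0..L}"
    by (rule absolutely_integrable_mult_continuous[OF aU primitive_on_continuous[OF P(1)]])
  have "(LINT x|lebesgue_on {0<..<L}. u' x * \<psi>' x) = (LINT x|lebesgue_on {0<..<L}. V x * \<psi>' x)"
  proof (rule integral_cong_AE)
    show "(\<lambda>x. u' x * \<psi>' x) \<in> borel_measurable (lebesgue_on {0<..<L})"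
      using u' \<psi> by (auto simp: L2_space_def intro!: borel_measurable_times)
    show "(\<lambda>x. V x * \<psi>' x) \<in> borel_measurable (lebesgue_on {0<..<L})"
      using i1 by (simp flip: integrable_Ioo_iff)
    show "AE x in lebesgue_on {0<..<L}. u' x * \<psi>' x = V x * \<psi>' x"
      using ae by eventually_elim simp
  qed
  also have "\<dots> = integral {0..L} (\<lambda>x. V x * \<psi>' x)" by (rule lebesgue_integral_Ioo[OF i1])
  also have "\<dots> = integral {0..L} (\<lambda>x. a x * U x * P x)"
  proof -
    have "((\<lambda>x. - (a x * U x) * P x + V x * \<psi>' x) has_integral 0) {0..L}"
      using primitive_onD(2)[OF primitive_on_mult[OF V P(1)], of 0 L] L bd by simp
    then have "integral {0..L} (\<lambda>x. V x * \<psi>' x - a x * U x * P x) = 0"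
      by (intro integral_unique) (simp add: algebra_simps)
    then show ?thesis
      using set_lebesgue_integral_eq_integral(1)[OF i1] set_lebesgue_integral_eq_integral(1)[OF i2]
      by (simp add: Henstock_Kurzweil_Integration.integral_diff)
  qed
  also have "\<dots> = (LINT x|lebesgue_on {0<..<L}. a x * U x * P x)" by (rule lebesgue_integral_Ioo[OF i2, symmetric])
  also have "\<dots> = (LINT x|lebesgue_on {0<..<L}. a x * U x * \<psi> x)"
  proof (rule integral_cong_AE)
    have "(\<lambda>x. a x * U x) \<in> borel_measurable (lebesgue_on {0<..<L})" using aU by (simp flip: integrable_Ioo_iff)
    then show "(\<lambda>x. a x * U x * \<psi> x) \<in> borel_measurable (lebesgue_on {0<..<L})"
      using \<psi>2 by (auto simp: L2_space_def intro!: borel_measurable_times)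
    show "(\<lambda>x. a x * U x * P x) \<in> borel_measurable (lebesgue_on {0<..<L})"
      using i2 by (simp flip: integrable_Ioo_iff)
    show "AE x in lebesgue_on {0<..<L}. a x * U x * P x = a x * U x * \<psi> x"
      using P(2) by eventually_elim simp
  qed
  finally show "(LINT x|lebesgue_on {0<..<L}. u' x * \<psi>' x) = (LINT x|lebesgue_on {0<..<L}. a x * U x * \<psi> x)" .
qed

text \<open>A function with \<open>n + 1\<close> half waves on \<open>[0, L]\<close> that equals \<open>\<plusminus> sin (\<omega> z)\<close>, \<open>z\<close> being the signed distance to
  the nearest zero, except within distance \<open>h\<close> of an extremum, where it is continued by a parabola. The
  excess of the potential over \<open>\<omega>\<^sup>2\<close> is then concentrated near the \<open>n + 2\<close> extrema.\<close>

locale concentrated_potential =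
  fixes L h :: real and n :: nat and \<omega> \<kappa> l g C D :: real
  assumes L: "L > 0" and n: "n \<ge> 1"
    and \<omega>_def: "\<omega> = real n * pi / L" and \<kappa>_def: "\<kappa> = (real n + 1) * pi / L"
    and l_def: "l = L / (2 * (real n + 1))" and g_def: "g = l - h"
    and D_def: "D = \<omega> * cos (\<omega> * g) / (2 * h)" and C_def: "C = sin (\<omega> * g) + D * h\<^sup>2"
    and h: "0 < h" "h < l" "\<omega> * h * (1 + \<omega> * h) < cos (\<omega> * l)"
begin

text \<open>A triangle wave of slope \<open>1\<close> or \<open>-1\<close> and amplitude
  \<open>l\<close>: the signed distance to the nearest zero, written without case
  distinctions.\<close>

definition wave_arg :: "real \<Rightarrow> real" where "wave_arg x = arcsin (cos (\<kappa> * x)) / \<kappa>"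

text \<open>An odd function. The parabola has its vertex at \<open>\<bar>z\<bar> = l\<close>;
  \<open>D\<close> is chosen to match the slope of the sine at \<open>\<bar>z\<bar> = g\<close>, and
  \<open>C\<close> then matches the value, so the join is continuously differentiable.\<close>

definition profile :: "real \<Rightarrow> real" where
  "profile z = (if \<bar>z\<bar> \<le> g then sin (\<omega> * z) else sgn z * (C - D * (l - \<bar>z\<bar>)\<^sup>2))"

definition profile_deriv :: "real \<Rightarrow> real" where
  "profile_deriv z = (if \<bar>z\<bar> \<le> g then \<omega> * cos (\<omega> * z) else 2 * D * (l - \<bar>z\<bar>))"

text \<open>Minus the second derivative of \<open>profile\<close> divided by \<open>profile\<close>;
  on the parabolic caps the numerator is the constant \<open>2 * D\<close> up to sign.\<close>

definition profile_potential :: "real \<Rightarrow> real" where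
  "profile_potential z = (if \<bar>z\<bar> \<le> g then \<omega>\<^sup>2 else 2 * D / (C - D * (l - \<bar>z\<bar>)\<^sup>2))"

definition wave :: "real \<Rightarrow> real" where "wave x = profile (wave_arg x)"

text \<open>The sign factor is the slope of the triangle wave. At the extrema
  \<open>sgn 0 = 0\<close>, so the formula gives the correct derivative zero there too.\<close>

definition wave_deriv :: "real \<Rightarrow> real" where
  "wave_deriv x = - (sgn (sin (\<kappa> * x)) * profile_deriv (wave_arg x))"

definition potential :: "real \<Rightarrow> real" where "potential x = profile_potential (wave_arg x)"

lemma constants:
  "\<omega> > 0" "\<kappa> > 0" "\<kappa> * l = pi / 2" "0 < g" "g < l" "\<omega> * l < pi / 2" "0 < \<omega> * g" "\<omega> * g < pi / 2" "2 * l * (real n + 1) = L"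
proof -
  define N where "N = real n + 1"
  have N: "N > 0" "real n < N" by (auto simp: N_def)
  show w: "\<omega> > 0" using L n by (simp add: \<omega>_def)
  show k: "\<kappa> > 0" using L by (simp add: \<kappa>_def add_pos_pos)
  show kl: "\<kappa> * l = pi / 2" using L N by (simp add: \<kappa>_def l_def flip: N_def)
  show L': "2 * l * (real n + 1) = L" using N by (simp add: l_def flip: N_def)
  show g: "0 < g" "g < l" using h by (auto simp: g_def)
  have "\<omega> < \<kappa>" unfolding \<omega>_def \<kappa>_def using L N
    by (intro divide_strict_right_mono mult_strict_right_mono) (auto simp flip: N_def)
  then show wl: "\<omega> * l < pi / 2" using mult_strict_right_mono[of \<omega> \<kappa> l] kl h by simp
  show "0 < \<omega> * g" using w g by simp
  have "\<omega> * g < \<omega> * l" using w g by simp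
  then show "\<omega> * g < pi / 2" using wl by linarith
qed

lemma sin_cos_pos: "sin (\<omega> * g) > 0" "cos (\<omega> * g) > 0" "D > 0" "C > 0"
proof -
  show 1: "sin (\<omega> * g) > 0" "cos (\<omega> * g) > 0"
    using constants(7,8) pi_gt_zero by (intro sin_gt_zero cos_gt_zero_pi; linarith)+
  then show "D > 0" using constants h by (simp add: D_def)
  then show "C > 0" using 1 h by (simp add: C_def add_pos_pos)
qed

text \<open>On a cap the potential is at least \<open>2 D / C\<close>, so this puts it above
  \<open>\<omega>\<^sup>2\<close>. The smallness condition on \<open>h\<close> is made for this
  purpose: \<open>2 D = \<omega> cos (\<omega> g) / h\<close>, while
  \<open>C \<le> 1 + \<omega> h\<close>.\<close>

lemma two_D_gt: "2 * D > \<omega>\<^sup>2 * C"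
proof -
  have "cos (\<omega> * l) \<le> cos (\<omega> * g)"
  proof (rule cos_monotone_0_pi_le)
    show "\<omega> * g \<le> \<omega> * l" using constants by simp
    show "0 \<le> \<omega> * g" "\<omega> * l \<le> pi" using constants(6,7) pi_gt_zero by linarith+
  qed
  then have 1: "\<omega> * h * (1 + \<omega> * h) < cos (\<omega> * g)" using h by simp
  have "D * h\<^sup>2 = \<omega> * h * cos (\<omega> * g) / 2" using h by (simp add: D_def power2_eq_square)
  also have "\<dots> \<le> \<omega> * h * 1" using constants h sin_cos_pos order_trans[OF cos_le_one[of "\<omega> * g"], of 2] by (simp add: divide_le_eq mult_le_cancel_left1)
  finally have "C \<le> 1 + \<omega> * h" unfolding C_def using sin_le_one[of "\<omega> * g"] by linarith
  then have "\<omega>\<^sup>2 * C \<le> \<omega>\<^sup>2 * (1 + \<omega> * h)" by (rule mult_left_mono) simp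
  moreover have "\<omega> * (\<omega> * h * (1 + \<omega> * h)) < \<omega> * cos (\<omega> * g)"
    using 1 constants(1) by (rule mult_strict_left_mono)
  then have "\<omega>\<^sup>2 * (1 + \<omega> * h) < \<omega> * cos (\<omega> * g) / h"
    using h by (simp add: less_divide_eq power2_eq_square mult_ac)
  ultimately show ?thesis using h by (simp add: D_def)
qed

text \<open>The extrema sit at \<open>2 l i\<close> for \<open>i \<le> n + 1\<close>, and rounding
  picks the nearest. Shifting by \<open>i\<close> half waves multiplies the cosine by
  \<open>(- 1) ^ i\<close>, which the absolute value removes.\<close>

lemma wave_arg_abs:
  assumes "x \<in> {0..L}"
  obtains i where "i \<le> n + 1" "\<bar>x - 2 * l * real i\<bar> \<le> l" "\<bar>wave_arg x\<bar> = l - \<bar>x - 2 * l * real i\<bar>"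
proof -
  define i where "i = nat (round (x / (2 * l)))"
  have l: "l > 0" using h by simp
  have x: "0 \<le> x / (2 * l)" "x / (2 * l) \<le> real n + 1"
    using assms l constants(9) by (auto simp: field_simps)
  have "0 \<le> round (x / (2 * l))" using round_mono[OF x(1)] by simp
  then have ri: "real_of_int (round (x / (2 * l))) = real i" by (simp add: i_def)
  have "round (x / (2 * l)) \<le> round (real (n + 1))" using x(2) by (intro round_mono) simp
  then have "round (x / (2 * l)) \<le> int (n + 1)" by (simp only: round_of_nat)
  then have i: "i \<le> n + 1" unfolding i_def by linarith
  define y where "y = x - 2 * l * real i"
  have "\<bar>real i - x / (2 * l)\<bar> \<le> 1 / 2" using of_int_round_abs_le[of "x / (2 * l)"] ri by simp
  then have y: "\<bar>y\<bar> \<le> l" using l by (simp add: y_def abs_le_iff field_simps)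
  have ky: "\<kappa> * \<bar>y\<bar> \<le> pi / 2" using mult_left_mono[OF y, of \<kappa>] constants by simp
  have "\<kappa> * x = real i * pi + \<kappa> * y" using constants(3) by (simp add: y_def algebra_simps)
  then have c: "cos (\<kappa> * x) = (- 1) ^ i * cos (\<kappa> * y)" by (simp add: cos_add)
  have "cos (\<kappa> * y) = cos (\<kappa> * \<bar>y\<bar>)" by (cases "y \<ge> 0") auto
  also have "\<dots> = sin (pi / 2 - \<kappa> * \<bar>y\<bar>)" by (simp add: sin_diff)
  finally have cy: "cos (\<kappa> * y) = sin (pi / 2 - \<kappa> * \<bar>y\<bar>)" .
  have kn: "0 \<le> \<kappa> * \<bar>y\<bar>" using constants by simp
  have "arcsin (cos (\<kappa> * y)) = pi / 2 - \<kappa> * \<bar>y\<bar>"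
    unfolding cy using ky kn by (intro arcsin_sin) linarith+
  moreover have "\<bar>arcsin (cos (\<kappa> * x))\<bar> = \<bar>arcsin (cos (\<kappa> * y))\<bar>"
    unfolding c by (cases "even i") (auto simp: arcsin_minus)
  ultimately have "\<bar>wave_arg x\<bar> = (pi / 2 - \<kappa> * \<bar>y\<bar>) / \<kappa>"
    using ky constants by (simp add: wave_arg_def)
  also have "\<dots> = l - \<bar>y\<bar>" using constants(2,3) by (simp add: field_simps)
  finally show ?thesis using that i y by (simp add: y_def)
qed

lemma wave_arg_le: "\<bar>wave_arg x\<bar> \<le> l"
proof -
  have "\<bar>arcsin (cos (\<kappa> * x))\<bar> \<le> \<kappa> * l"
    unfolding constants(3) abs_le_iff using arcsin_lbound[of "cos (\<kappa> * x)"] arcsin_ubound[of "cos (\<kappa> * x)"] by simp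
  then show ?thesis using constants by (simp add: wave_arg_def divide_le_eq mult.commute)
qed

lemma wave_arg_continuous: "continuous_on A wave_arg"
  unfolding wave_arg_def[abs_def] using constants by (intro continuous_intros) auto

lemma wave_arg_deriv:
  assumes "sin (\<kappa> * x) \<noteq> 0"
  shows "(wave_arg has_real_derivative - sgn (sin (\<kappa> * x))) (at x)"
proof -
  have sq: "(sin (\<kappa> * x))\<^sup>2 = 1 - (cos (\<kappa> * x))\<^sup>2" using sin_squared_eq .
  have "(sin (\<kappa> * x))\<^sup>2 > 0" using assms by simp
  then have "(cos (\<kappa> * x))\<^sup>2 < 1" unfolding sq by simp
  then have "- 1 < cos (\<kappa> * x)" "cos (\<kappa> * x) < 1" by (auto simp: abs_square_less_1 abs_less_iff)
  moreover have "sqrt (1 - (cos (\<kappa> * x))\<^sup>2) = \<bar>sin (\<kappa> * x)\<bar>" unfolding sq[symmetric] by simp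
  ultimately show ?thesis
    unfolding wave_arg_def[abs_def] using constants assms
    by (auto intro!: derivative_eq_intros simp: sgn_if divide_simps)
qed

lemma profile_continuous: "continuous_on A profile"
proof -
  have "continuous_on UNIV profile"
    unfolding profile_def[abs_def]
  proof (rule continuous_on_cases_le)
    show "continuous_on {t \<in> UNIV. g \<le> \<bar>t\<bar>} (\<lambda>z. sgn z * (C - D * (l - \<bar>z\<bar>)\<^sup>2))"
      using constants by (intro continuous_intros) auto
    fix t assume "\<bar>t\<bar> = g"
    then have "t = g \<or> t = - g" by linarith
    moreover have "l - g = h" by (simp add: g_def)
    ultimately show "sin (\<omega> * t) = sgn t * (C - D * (l - \<bar>t\<bar>)\<^sup>2)"
      using constants(4) by (auto simp: C_def)
  qed (intro continuous_intros)+
  then show ?thesis using continuous_on_subset by blast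
qed

lemma profile_deriv_continuous: "continuous_on A profile_deriv"
proof -
  have "continuous_on UNIV profile_deriv"
    unfolding profile_deriv_def[abs_def]
  proof (rule continuous_on_cases_le)
    fix t assume "\<bar>t\<bar> = g"
    then have "t = g \<or> t = - g" by linarith
    moreover have "l - g = h" by (simp add: g_def)
    ultimately show "\<omega> * cos (\<omega> * t) = 2 * D * (l - \<bar>t\<bar>)"
      using constants(4) h by (auto simp: D_def)
  qed (intro continuous_intros)+
  then show ?thesis using continuous_on_subset by blast
qed

lemma profile_denom: 
  assumes "g \<le> \<bar>z\<bar>" "\<bar>z\<bar> \<le> l"
  shows "sin (\<omega> * g) \<le> C - D * (l - \<bar>z\<bar>)\<^sup>2" "C - D * (l - \<bar>z\<bar>)\<^sup>2 \<le> C"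
proof -
  have "(l - \<bar>z\<bar>)\<^sup>2 \<le> h\<^sup>2" using assms by (intro power_mono) (auto simp: g_def)
  then have "D * (l - \<bar>z\<bar>)\<^sup>2 \<le> D * h\<^sup>2" using sin_cos_pos by simp
  then show "sin (\<omega> * g) \<le> C - D * (l - \<bar>z\<bar>)\<^sup>2" by (simp add: C_def)
  show "C - D * (l - \<bar>z\<bar>)\<^sup>2 \<le> C" using sin_cos_pos by simp
qed

lemma profile_has_deriv:
  assumes "\<bar>z\<bar> \<noteq> g" "\<bar>z\<bar> \<le> l"
  shows "(profile has_real_derivative profile_deriv z) (at z)"
    and "(profile_deriv has_real_derivative - (profile_potential z * profile z)) (at z)"
proof -
  have ne: "C - D * (l - \<bar>z\<bar>)\<^sup>2 \<noteq> 0" if "\<bar>z\<bar> > g"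
    using profile_denom[of z] sin_cos_pos that assms by auto
  consider "\<bar>z\<bar> < g" | "z > g" | "z < - g" using assms by linarith
  then have "(profile has_real_derivative profile_deriv z) (at z) \<and>
    (profile_deriv has_real_derivative - (profile_potential z * profile z)) (at z)"
  proof cases
    case 1
    have "((\<lambda>z. sin (\<omega> * z)) has_real_derivative profile_deriv z) (at z)"
      "((\<lambda>z. \<omega> * cos (\<omega> * z)) has_real_derivative - (profile_potential z * profile z)) (at z)"
      using 1 by (auto intro!: derivative_eq_intros simp: profile_def profile_deriv_def profile_potential_def power2_eq_square)
    then show ?thesis
      using 1 by (auto elim!: has_field_derivative_transform_within_open[of _ _ _ "{-g<..<g}"]
          simp: profile_def profile_deriv_def)
  next
    case 2
    have "((\<lambda>z. C - D * (l - z)\<^sup>2) has_real_derivative profile_deriv z) (at z)"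
      "((\<lambda>z. 2 * D * (l - z)) has_real_derivative - (profile_potential z * profile z)) (at z)"
      using 2 constants ne by (auto intro!: derivative_eq_intros simp: profile_def profile_deriv_def profile_potential_def)
        (simp add: algebra_simps)
    then show ?thesis
      using 2 constants by (auto elim!: has_field_derivative_transform_within_open[of _ _ _ "{g<..}"]
          simp: profile_def profile_deriv_def)
  next
    case 3
    define E where "E = C - D * (l - \<bar>z\<bar>)\<^sup>2"
    have "E \<noteq> 0" "profile z = sgn z * E" "profile_potential z = 2 * D / E"
      using 3 constants(4) ne unfolding E_def profile_def profile_potential_def by (auto simp only: split: if_splits)
    then have "profile_potential z * profile z = 2 * D * sgn z" by simp
    then have "profile_potential z * profile z = - (2 * D)" using 3 constants(4) by simp
    then have "((\<lambda>z. - (C - D * (l + z)\<^sup>2)) has_real_derivative profile_deriv z) (at z)"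
      "((\<lambda>z. 2 * D * (l + z)) has_real_derivative - (profile_potential z * profile z)) (at z)"
      using 3 constants by (auto intro!: derivative_eq_intros simp: profile_deriv_def)
    then show ?thesis
      using 3 constants by (auto elim!: has_field_derivative_transform_within_open[of _ _ _ "{..<-g}"]
          simp: profile_def profile_deriv_def)
  qed
  then show "(profile has_real_derivative profile_deriv z) (at z)"
    "(profile_deriv has_real_derivative - (profile_potential z * profile z)) (at z)" by auto
qed

lemma wave_continuous: "continuous_on A wave"
  unfolding wave_def[abs_def]
  by (rule continuous_on_compose2[OF profile_continuous wave_arg_continuous subset_UNIV])

text \<open>The sign factor jumps exactly at the extrema, where \<open>profile_deriv\<close>
  vanishes because \<open>\<bar>z\<bar> = l\<close>; a bounded factor times a null function is
  continuous there.\<close>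

lemma wave_deriv_continuous: "continuous_on A wave_deriv"
proof -
  have c: "isCont (\<lambda>x. profile_deriv (wave_arg x)) x" for x
    using continuous_on_compose2[OF profile_deriv_continuous wave_arg_continuous subset_UNIV, of UNIV]
    by (auto simp: continuous_on_eq_continuous_at)
  have "isCont wave_deriv x" for x
  proof (cases "sin (\<kappa> * x) = 0")
    case False
    then show ?thesis
      unfolding wave_deriv_def[abs_def] by (intro continuous_intros c) auto
  next
    case True
    have "cos (\<kappa> * x) = 1 \<or> cos (\<kappa> * x) = -1" using sin_zero_abs_cos_one[OF True] by linarith
    then have "\<bar>wave_arg x\<bar> = pi / 2 / \<kappa>" using constants by (auto simp: wave_arg_def)
    also have "\<dots> = l" using constants(2,3) by (simp add: field_simps)
    finally have "profile_deriv (wave_arg x) = 0" using constants by (simp add: profile_deriv_def)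
    then have "((\<lambda>y. profile_deriv (wave_arg y)) \<longlongrightarrow> 0) (at x)" using c[of x] by (simp add: isCont_def)
    then have "(wave_deriv \<longlongrightarrow> 0) (at x)"
      by (rule Lim_null_comparison[OF always_eventually tendsto_rabs_zero, rotated])
         (auto simp: wave_deriv_def abs_mult sgn_if)
    then show ?thesis using True by (simp add: isCont_def wave_deriv_def)
  qed
  then show ?thesis using continuous_at_imp_continuous_on by blast
qed

lemma wave_has_deriv:
  assumes "sin (\<kappa> * x) \<noteq> 0" "\<bar>wave_arg x\<bar> \<noteq> g"
  shows "(wave has_real_derivative wave_deriv x) (at x)"
    and "(wave_deriv has_real_derivative - (potential x * wave x)) (at x)"
proof -
  note d = profile_has_deriv[OF assms(2) wave_arg_le]
  show "(wave has_real_derivative wave_deriv x) (at x)"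
    unfolding wave_def[abs_def] wave_deriv_def
    by (rule DERIV_cong[OF DERIV_chain2[OF d(1) wave_arg_deriv[OF assms(1)]]]) simp
  have "((\<lambda>y. - (sgn (sin (\<kappa> * x)) * profile_deriv (wave_arg y))) has_real_derivative - (potential x * wave x)) (at x)"
    unfolding potential_def wave_def
    by (rule DERIV_cong[OF DERIV_minus[OF DERIV_cmult[OF DERIV_chain2[OF d(2) wave_arg_deriv[OF assms(1)]]]]])
       (use assms(1) in \<open>simp add: sgn_if\<close>)
  \<comment> \<open>On this neighbourhood of \<open>x\<close> the sign is constant, so it may be
    frozen while differentiating.\<close>
  moreover have "open {y. sgn (sin (\<kappa> * x)) * sin (\<kappa> * y) > 0}"
    by (intro open_Collect_less continuous_intros)
  ultimately show "(wave_deriv has_real_derivative - (potential x * wave x)) (at x)"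
    by (rule has_field_derivative_transform_within_open)
       (use assms(1) in \<open>auto simp: wave_deriv_def sgn_if split: if_splits\<close>)
qed

lemma potential_bounds:
  "\<omega>\<^sup>2 \<le> potential x" "potential x \<le> (if \<bar>wave_arg x\<bar> \<le> g then \<omega>\<^sup>2 else 2 * D / sin (\<omega> * g))"
  "\<bar>wave_arg x\<bar> > g \<Longrightarrow> \<omega>\<^sup>2 < potential x"
proof -
  have "\<omega>\<^sup>2 < potential x \<and> potential x \<le> 2 * D / sin (\<omega> * g)" if "\<bar>wave_arg x\<bar> > g"
  proof -
    define E where "E = C - D * (l - \<bar>wave_arg x\<bar>)\<^sup>2"
    have E: "sin (\<omega> * g) \<le> E" "E \<le> C"
      unfolding E_def using profile_denom[OF _ wave_arg_le] that by auto
    have E0: "E > 0" using E sin_cos_pos by linarith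
    have "\<omega>\<^sup>2 * E \<le> \<omega>\<^sup>2 * C" using E by (intro mult_left_mono) auto
    then have "\<omega>\<^sup>2 * E < 2 * D" using two_D_gt by linarith
    then have "\<omega>\<^sup>2 < 2 * D / E" using E0 by (simp add: less_divide_eq)
    moreover have "2 * D / E \<le> 2 * D / sin (\<omega> * g)"
      using E sin_cos_pos by (intro divide_left_mono) auto
    ultimately show ?thesis using that by (simp add: potential_def profile_potential_def E_def)
  qed
  then show "\<omega>\<^sup>2 \<le> potential x" "potential x \<le> (if \<bar>wave_arg x\<bar> \<le> g then \<omega>\<^sup>2 else 2 * D / sin (\<omega> * g))"
    "\<bar>wave_arg x\<bar> > g \<Longrightarrow> \<omega>\<^sup>2 < potential x"
    by (cases "\<bar>wave_arg x\<bar> \<le> g"; force simp: potential_def profile_potential_def)+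
qed

lemma potential_measurable: "potential \<in> borel_measurable borel"
proof -
  have [measurable]: "wave_arg \<in> borel_measurable borel"
    by (rule borel_measurable_continuous_onI[OF wave_arg_continuous])
  show ?thesis unfolding potential_def[abs_def] profile_potential_def by measurable
qed

lemma potential_integrable: "potential absolutely_integrable_on {0..L}"
proof (rule measurable_bounded_by_integrable_imp_absolutely_integrable)
  show "potential \<in> borel_measurable (lebesgue_on {0..L})"
    using potential_measurable by (intro measurable_restrict_space1 measurable_completion) simp
  show "(\<lambda>x. \<omega>\<^sup>2 + 2 * D / sin (\<omega> * g)) integrable_on {0..L}" by (intro integrable_const_ivl)
  show "norm (potential x) \<le> \<omega>\<^sup>2 + 2 * D / sin (\<omega> * g)" if "x \<in> {0..L}" for x
  proof -
    have "0 \<le> \<omega>\<^sup>2" "0 \<le> 2 * D / sin (\<omega> * g)" using sin_cos_pos by auto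
    moreover from this have "(if \<bar>wave_arg x\<bar> \<le> g then \<omega>\<^sup>2 else 2 * D / sin (\<omega> * g)) \<le> \<omega>\<^sup>2 + 2 * D / sin (\<omega> * g)"
      by (simp del: zero_le_power2)
    ultimately show ?thesis using potential_bounds(1,2)[of x] unfolding real_norm_def by linarith
  qed
qed auto

lemma wave_weak_solution: "weak_neumann_solution L potential wave"
proof (rule weak_neumann_solutionI[OF L potential_integrable])
  \<comment> \<open>The extrema together with the junctions of sine and parabola: the only points
    where differentiability of \<open>wave\<close> or \<open>wave_deriv\<close> is not
    verified.\<close>
  define X where "X = (\<Union>i\<in>{..n+1}. {2 * l * real i, 2 * l * real i + h, 2 * l * real i - h})"
  have X: "finite X" by (simp add: X_def)
  have off: "sin (\<kappa> * x) \<noteq> 0 \<and> \<bar>wave_arg x\<bar> \<noteq> g" if x: "x \<in> {0<..<L} - X" for x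
  proof -
    have "x \<in> {0..L}" using x by simp
    then obtain i where i: "i \<le> n + 1" "\<bar>x - 2 * l * real i\<bar> \<le> l" "\<bar>wave_arg x\<bar> = l - \<bar>x - 2 * l * real i\<bar>"
      by (rule wave_arg_abs)
    have ne: "x \<noteq> 2 * l * real i" "x \<noteq> 2 * l * real i + h" "x \<noteq> 2 * l * real i - h"
      using x i(1) unfolding X_def by auto
    have "sin (\<kappa> * x) \<noteq> 0"
    proof
      assume "sin (\<kappa> * x) = 0"
      then have "cos (\<kappa> * x) = 1 \<or> cos (\<kappa> * x) = -1" using sin_zero_abs_cos_one[of "\<kappa> * x"] by linarith
      then have "\<bar>wave_arg x\<bar> = pi / 2 / \<kappa>" using constants by (auto simp: wave_arg_def)
      also have "\<dots> = l" using constants(2,3) by (simp add: field_simps)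
      finally show False using i(3) ne(1) by simp
    qed
    moreover have "\<bar>wave_arg x\<bar> \<noteq> g" using i(3) ne(2,3) by (auto simp: g_def abs_if split: if_splits)
    ultimately show ?thesis by blast
  qed
  show "primitive_on 0 L wave wave_deriv"
    using off wave_has_deriv(1)
    by (intro primitive_on_derivative_off_finite[OF X wave_continuous]
        absolutely_integrable_continuous_real wave_deriv_continuous) blast
  have "(\<lambda>x. - (potential x * wave x)) absolutely_integrable_on {0..L}"
    using absolutely_integrable_mult_continuous[OF potential_integrable wave_continuous]
    by (simp add: set_integrable_def)
  then show "primitive_on 0 L wave_deriv (\<lambda>x. - (potential x * wave x))"
    using off wave_has_deriv(2)
    by (intro primitive_on_derivative_off_finite[OF X wave_deriv_continuous]) blast+
  show "wave_deriv 0 = 0" by (simp add: wave_deriv_def)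
  have "\<kappa> * L = real (n + 1) * pi" using L by (simp add: \<kappa>_def)
  then show "wave_deriv L = 0" by (simp only: wave_deriv_def sin_npi) simp
qed

lemma wave_arg_start: "x \<in> {0..l} \<Longrightarrow> wave_arg x = l - x"
proof -
  assume x: "x \<in> {0..l}"
  have "\<kappa> * x \<le> \<kappa> * l" "0 \<le> \<kappa> * x" using x constants by auto
  moreover have "cos (\<kappa> * x) = sin (pi / 2 - \<kappa> * x)" by (simp add: sin_diff)
  ultimately have "wave_arg x = (pi / 2 - \<kappa> * x) / \<kappa>"
    using constants(3) unfolding wave_arg_def by (simp add: arcsin_sin)
  also have "\<dots> = l - x" using constants(2,3) by (simp add: field_simps)
  finally show ?thesis .
qed

text \<open>The cap \<open>(0, h)\<close> at the left end supplies a set of positive measure where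
  the potential exceeds \<open>\<omega>\<^sup>2\<close>; nontriviality is seen on
  \<open>(h, l)\<close>, where the wave is \<open>sin (\<omega> (l - x)) > 0\<close>.\<close>

lemma potential_in_Lambda_set: "potential \<in> Lambda_set L n"
proof -
  have w2: "neumann_eigenvalue L n = \<omega>\<^sup>2"
    by (simp add: neumann_eigenvalue_def \<omega>_def power_mult_distrib power_divide)
  have "{0<..<h} \<subseteq> {x \<in> {0..L}. \<omega>\<^sup>2 < potential x}"
  proof
    fix x assume x: "x \<in> {0<..<h}"
    have "l \<le> L" using L n by (simp add: l_def field_simps)
    moreover have "\<bar>wave_arg x\<bar> > g" using x h wave_arg_start[of x] by (simp add: g_def)
    ultimately show "x \<in> {x \<in> {0..L}. \<omega>\<^sup>2 < potential x}"
      using x h potential_bounds(3)[of x] by auto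
  qed
  moreover have "{x \<in> {0..L}. \<omega>\<^sup>2 < potential x} \<in> sets lebesgue"
  proof -
    have [measurable]: "potential \<in> borel_measurable borel" by (rule potential_measurable)
    have "{x \<in> {0..L}. \<omega>\<^sup>2 < potential x} \<in> sets borel" by measurable
    then show ?thesis by (simp add: sets_completionI_sets)
  qed
  ultimately have "emeasure lebesgue {0<..<h} \<le> emeasure lebesgue {x \<in> {0..L}. \<omega>\<^sup>2 < potential x}"
    by (rule emeasure_mono)
  moreover have "emeasure lebesgue {0<..<h} > 0" using h by simp
  ultimately have "prec_ae L (\<lambda>x. \<omega>\<^sup>2) potential"
    unfolding prec_ae_def using potential_bounds(1) by (auto intro: less_le_trans)
  moreover have "nontrivial L wave"
    unfolding nontrivial_def
  proof
    assume "AE x in lebesgue_on {0<..<L}. wave x = 0"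
    then have "AE x in lebesgue. x \<in> {0<..<L} \<longrightarrow> wave x = 0"
      by (subst (asm) AE_restrict_space_iff) auto
    then have "AE x in lebesgue. x \<in> {h<..<l} \<longrightarrow> wave x = 0"
    proof eventually_elim
      case (elim x)
      have "l \<le> L" using L n by (simp add: l_def field_simps)
      then show ?case using elim h by auto
    qed
    then have "AE x in lebesgue_on {h<..<l}. wave x = 0"
      by (subst AE_restrict_space_iff) auto
    then obtain x where x: "x \<in> {h<..<l}" "wave x = 0" using AE_Ioo_ex[OF h(2)] by blast
    have "\<bar>l - x\<bar> \<le> g" "wave_arg x = l - x" using x wave_arg_start[of x] h by (auto simp: g_def)
    then have "sin (\<omega> * (l - x)) = 0" using x(2) by (simp add: wave_def profile_def)
    moreover have "0 < \<omega> * (l - x)" using x constants by simp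
    moreover have "\<omega> * (l - x) < \<omega> * l" using x h constants by simp
    ultimately show False using constants(6) sin_gt_zero[of "\<omega> * (l - x)"] by linarith
  qed
  ultimately show ?thesis
    unfolding Lambda_set_def w2 L1_space_def
    using potential_integrable wave_weak_solution by (auto simp: integrable_Ioo_iff)
qed

text \<open>The excess lives on the caps, of total length \<open>2 (n + 1) h\<close>, and is at most
  \<open>M = \<omega> cot (\<omega> g) / h\<close> there, so the width \<open>h\<close>
  cancels.\<close>

lemma potential_norm:
  "L1_norm L (\<lambda>x. potential x - neumann_eigenvalue L n) \<le> 2 * (real n + 1) * \<omega> * cot (\<omega> * g)"
proof -
  have w2: "neumann_eigenvalue L n = \<omega>\<^sup>2"
    by (simp add: neumann_eigenvalue_def \<omega>_def power_mult_distrib power_divide)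
  define M where "M = 2 * D / sin (\<omega> * g)"
  define J where "J i = {2 * l * real i - h..2 * l * real i + h}" for i
  have M: "M > 0" using sin_cos_pos by (simp add: M_def)
  have di: "(\<lambda>x. potential x - \<omega>\<^sup>2) absolutely_integrable_on {0..L}"
    by (intro set_integral_diff(1) potential_integrable absolutely_integrable_continuous_real continuous_on_const)
  have Jm: "{0..L} \<inter> J i \<in> lmeasurable" for i
    unfolding J_def by (simp add: Int_atLeastAtMost)
  then have Ji: "(\<lambda>x. indicator (J i) x * M) integrable_on {0..L}" for i
    by (intro integrable_on_mult_left) (simp add: integrable_on_indicator Int_commute)
  have bound: "potential x - \<omega>\<^sup>2 \<le> (\<Sum>i\<in>{..n+1}. indicator (J i) x * M)" if x: "x \<in> {0..L}" for x
  proof (cases "\<bar>wave_arg x\<bar> \<le> g")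
    case True
    then have "potential x - \<omega>\<^sup>2 = 0" by (simp add: potential_def profile_potential_def)
    also have "0 \<le> (\<Sum>i\<in>{..n+1}. indicator (J i) x * M)" using M by (intro sum_nonneg) auto
    finally show ?thesis .
  next
    case False
    obtain i where i: "i \<le> n + 1" "\<bar>wave_arg x\<bar> = l - \<bar>x - 2 * l * real i\<bar>"
      using wave_arg_abs[OF x] by metis
    then have "x \<in> J i" using False by (auto simp: J_def g_def abs_if split: if_splits)
    have "potential x \<le> M" using potential_bounds(2)[of x] False by (simp add: M_def)
    then have "potential x - \<omega>\<^sup>2 \<le> M" using zero_le_power2[of \<omega>] by linarith
    also have "M = indicator (J i) x * M" using \<open>x \<in> J i\<close> by simp
    also have "\<dots> \<le> (\<Sum>i\<in>{..n+1}. indicator (J i) x * M)"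
      using M i(1) by (intro member_le_sum) auto
    finally show ?thesis .
  qed
  \<comment> \<open>The caps at \<open>0\<close> and at \<open>2 l (n + 1) = L\<close> stick out of
    the interval by half. Thus \<open>n + 2\<close> caps count as \<open>n + 1\<close> full
    ones.\<close>
  have mJ: "measure lebesgue ({0..L} \<inter> J i) \<le> 2 * h - (if i = 0 then h else 0) - (if i = n + 1 then h else 0)"
    if "i \<le> n + 1" for i
  proof -
    have sub: "{0..L} \<inter> J i \<subseteq> {2 * l * real i - h + (if i = 0 then h else 0)..2 * l * real i + h - (if i = n + 1 then h else 0)}"
      using constants(9) by (auto simp: J_def algebra_simps)
    have "measure lebesgue ({0..L} \<inter> J i) \<le>
      measure lebesgue {2 * l * real i - h + (if i = 0 then h else 0)..2 * l * real i + h - (if i = n + 1 then h else 0)}"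
      using sub Jm by (intro measure_mono_fmeasurable) auto
    also have "\<dots> = 2 * h - (if i = 0 then h else 0) - (if i = n + 1 then h else 0)"
      using h by auto
    finally show ?thesis .
  qed
  have "L1_norm L (\<lambda>x. potential x - \<omega>\<^sup>2) = (LINT x|lebesgue_on {0<..<L}. potential x - \<omega>\<^sup>2)"
    unfolding L1_norm_def using potential_bounds(1) by (intro Bochner_Integration.integral_cong) auto
  also have "\<dots> = integral {0..L} (\<lambda>x. potential x - \<omega>\<^sup>2)" by (rule lebesgue_integral_Ioo[OF di])
  also have "\<dots> \<le> integral {0..L} (\<lambda>x. \<Sum>i\<in>{..n+1}. indicator (J i) x * M)"
    by (intro integral_le set_lebesgue_integral_eq_integral(1)[OF di] integrable_sum Ji bound) auto
  also have "\<dots> = (\<Sum>i\<in>{..n+1}. integral {0..L} (\<lambda>x. indicator (J i) x * M))"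
    by (intro Henstock_Kurzweil_Integration.integral_sum Ji) auto
  also have "\<dots> = (\<Sum>i\<in>{..n+1}. measure lebesgue ({0..L} \<inter> J i) * M)"
    using Jm by (simp add: integral_indicator Int_commute)
  also have "\<dots> \<le> (\<Sum>i\<in>{..n+1}. (2 * h - (if i = 0 then h else 0) - (if i = n + 1 then h else 0)) * M)"
    using M by (intro sum_mono mult_right_mono mJ) auto
  also have "\<dots> = (2 * (real n + 1) * h) * M"
    unfolding sum_distrib_right[symmetric] sum_subtractf by (simp add: algebra_simps)
  also have "\<dots> = 2 * (real n + 1) * \<omega> * cot (\<omega> * g)"
    using h by (simp add: M_def D_def cot_def)
  finally show ?thesis unfolding w2 .
qed

end

text \<open>Letting \<open>h\<close> tend to \<open>0\<close> from the right, \<open>g\<close> tends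
  to \<open>l\<close> and the bound to its value at \<open>\<omega> l\<close>, where
  \<open>cot\<close> is continuous. All small \<open>h\<close> are admissible because
  \<open>cos (\<omega> l) > 0\<close>.\<close>

lemma beta1_le:
  fixes L :: real and n :: nat
  assumes L: "L > 0" and n: "n \<ge> 1"
  shows "beta1 L n \<le> ereal (2 * pi * real n * (real n + 1) / L * cot (pi * real n / (2 * (real n + 1))))"
proof -
  define \<omega> l where "\<omega> = real n * pi / L" and "l = L / (2 * (real n + 1))"
  have \<omega>l: "\<omega> * l = pi * real n / (2 * (real n + 1))"
    using L by (simp add: \<omega>_def l_def)
  have rn: "0 < real n" "real n / (real n + 1) < 1" using n by auto
  have "\<omega> * l = (pi / 2) * (real n / (real n + 1))" unfolding \<omega>l by simp
  moreover have "(pi / 2) * (real n / (real n + 1)) < (pi / 2) * 1"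
    using rn(2) by (intro mult_strict_left_mono) auto
  ultimately have lt: "0 < \<omega> * l" "\<omega> * l < pi / 2" using rn by auto
  have l: "l > 0" using L by (simp add: l_def add_pos_pos)
  have bound: "beta1 L n \<le> ereal (2 * (real n + 1) * \<omega> * cot (\<omega> * (l - h)))"
    if h: "0 < h" "h < l" "\<omega> * h * (1 + \<omega> * h) < cos (\<omega> * l)" for h
  proof -
    interpret concentrated_potential L h n \<omega> "(real n + 1) * pi / L" l "l - h"
        "sin (\<omega> * (l - h)) + \<omega> * cos (\<omega> * (l - h)) / (2 * h) * h\<^sup>2" "\<omega> * cos (\<omega> * (l - h)) / (2 * h)"
      by unfold_locales (use L n h in \<open>simp_all add: \<omega>_def l_def\<close>)
    have "beta1 L n \<le> ereal (L1_norm L (\<lambda>x. potential x - neumann_eigenvalue L n))"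
      unfolding beta1_def by (rule INF_lower[OF potential_in_Lambda_set])
    also have "\<dots> \<le> ereal (2 * (real n + 1) * \<omega> * cot (\<omega> * (l - h)))"
      using potential_norm by simp
    finally show ?thesis .
  qed
  have "((\<lambda>h. \<omega> * h * (1 + \<omega> * h)) \<longlongrightarrow> \<omega> * 0 * (1 + \<omega> * 0)) (at_right 0)"
    by (intro tendsto_intros)
  moreover have "cos (\<omega> * l) > 0" using lt by (intro cos_gt_zero)
  ultimately have "\<forall>\<^sub>F h in at_right 0. \<omega> * h * (1 + \<omega> * h) < cos (\<omega> * l)"
    by (intro order_tendstoD(2)[where y = "\<omega> * 0 * (1 + \<omega> * 0)"]) auto
  moreover have "\<forall>\<^sub>F h in at_right 0. h \<in> {0<..<l}"
    using l by (rule eventually_at_right_real)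
  ultimately have ev: "\<forall>\<^sub>F h in at_right 0. beta1 L n \<le> ereal (2 * (real n + 1) * \<omega> * cot (\<omega> * (l - h)))"
    by eventually_elim (intro bound, auto)
  have "sin (\<omega> * l) \<noteq> 0" using sin_gt_zero[of "\<omega> * l"] lt by auto
  then have "((\<lambda>h. 2 * (real n + 1) * \<omega> * cot (\<omega> * (l - h))) \<longlongrightarrow> 2 * (real n + 1) * \<omega> * cot (\<omega> * (l - 0))) (at_right 0)"
    by (intro tendsto_intros) auto
  then have "((\<lambda>h. ereal (2 * (real n + 1) * \<omega> * cot (\<omega> * (l - h)))) \<longlongrightarrow> ereal (2 * (real n + 1) * \<omega> * cot (\<omega> * l))) (at_right 0)"
    by simp
  from tendsto_lowerbound[OF this ev] have "beta1 L n \<le> ereal (2 * (real n + 1) * \<omega> * cot (\<omega> * l))" by simp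
  also have "2 * (real n + 1) * \<omega> * cot (\<omega> * l) =
      2 * pi * real n * (real n + 1) / L * cot (pi * real n / (2 * (real n + 1)))"
    unfolding \<omega>l by (simp add: \<omega>_def)
  finally show ?thesis .
qed

theorem theorem2p1:
  fixes L :: real and n :: nat
  assumes "L > 0" and "n \<ge> 1"
  shows "beta1 L n =
           ereal (2 * pi * real n * (real n + 1) / L * cot (pi * real n / (2 * (real n + 1)))) \<and>
         \<not> (\<exists>a\<in>Lambda_set L n. ereal (L1_norm L (\<lambda>x. a x - neumann_eigenvalue L n)) = beta1 L n)"
proof -
  let ?\<beta> = "2 * pi * real n * (real n + 1) / L * cot (pi * real n / (2 * (real n + 1)))"
  have strict: "ereal ?\<beta> < ereal (L1_norm L (\<lambda>x. a x - neumann_eigenvalue L n))" if "a \<in> Lambda_set L n" for a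
    using Lambda_set_lower_bound[OF assms that] by simp
  then have "ereal ?\<beta> \<le> beta1 L n"
    unfolding beta1_def by (intro INF_greatest) (blast intro: less_imp_le)
  then have "beta1 L n = ereal ?\<beta>" using beta1_le[OF assms] by (rule antisym[rotated])
  then show ?thesis using strict by fastforce
qed

end
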